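(* Let $0<\beta\le 1<\alpha\le 2$, $a>0$ and $b\in\mathbb{C}$. Consider the linear fractional difference equation $$\Delta^{\alpha}x(t)+a\,\Delta^{\beta}x(t+\alpha-\beta-1)=(b-1)\,x(t+\alpha-2),\qquad t\in\mathbb{N}_{2-\alpha},$$ with initial data $x(0)=x_0$, $x(1)=x_1$. Define $$D_b(z)=z^2(1-z^{-1})^{\alpha}+a\,z(1-z^{-1})^{\beta}+1-b,$$ where the principal branches of the fractional powers are used, and for $\theta\in[0,2\pi]$ let $$\gamma(\theta)=2^{\alpha}\Bigl(\sin\tfrac{\theta}{2}\Bigr)^{\alpha}e^{\mathrm{i}\left[\frac{\alpha\pi}{2}+\theta\left(2-\frac{\alpha}{2}\right)\right]}+a\,2^{\beta}\Bigl(\sin\tfrac{\theta}{2}\Bigr)^{\beta}e^{\mathrm{i}\left[\frac{\beta\pi}{2}+\theta\left(1-\frac{\beta}{2}\right)\right]}+1,$$ so that $\gamma(\theta)-b=D_b(e^{\mathrm{i}\theta})$. If $b\notin\gamma([0,2\pi])$, then the zero solution of the equation is asymptotically stable if and only if $$\operatorname{Ind}_{\gamma}(b)=2.$$ Equivalently, the stability region is $$\mathcal{S}_{\alpha,\beta,a}=\bigl\{b\in\mathbb{C}\setminus\gamma([0,2\pi]):\operatorname{Ind}_{\gamma}(b)=2\bigr\}.$$ Its boundary is the curve $b=\gamma(\theta)$, $\theta\in[0,2\pi]$, or equivalently the curve $(\gamma_1(\theta),\gamma_2(\theta))$, $\theta\in[0,2\pi]$, with real and imaginary parts $$\gamma_1(\theta)=2^\alpha\bigl(\sin\tfrac{\theta}{2}\bigr)^\alpha\cos\Bigl(\tfrac{\alpha\pi}{2}+\theta\bigl(2-\tfrac{\alpha}{2}\bigr)\Bigr)+a\,2^\beta\bigl(\sin\tfrac{\theta}{2}\bigr)^\beta\cos\Bigl(\tfrac{\beta\pi}{2}+\theta\bigl(1-\tfrac{\beta}{2}\bigr)\Bigr)+1,$$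 $$\gamma_2(\theta)=2^\alpha\bigl(\sin\tfrac{\theta}{2}\bigr)^\alpha\sin\Bigl(\tfrac{\alpha\pi}{2}+\theta\bigl(2-\tfrac{\alpha}{2}\bigr)\Bigr)+a\,2^\beta\bigl(\sin\tfrac{\theta}{2}\bigr)^\beta\sin\Bigl(\tfrac{\beta\pi}{2}+\theta\bigl(1-\tfrac{\beta}{2}\bigr)\Bigr).$$
   Context: Notation: $\mathbb{N}_0=\{0,1,2,\dots\}$, $\mathbb{N}_r=\{r,r+1,r+2,\dots\}$ for real $r$. The unknown is a sequence $x:\mathbb{N}_0\to\mathbb{C}$. Fractional sum of order $\nu>0$: $(\Delta^{-\nu}x)(t)=\frac{1}{\Gamma(\nu)}\sum_{s=0}^{n}\frac{\Gamma(n-s+\nu)}{\Gamma(n-s+1)}x(s)$ for $t=\nu+n$, $n\in\mathbb{N}_0$. Caputo-like difference: for $m-1<\mu<m$, $m\in\mathbb{N}$, $\Delta^{\mu}x(t)=\Delta^{-(m-\mu)}(\Delta^m x)(t)$, $t\in\mathbb{N}_{m-\mu}$, where $\Delta^m x(t)=\sum_{k=0}^m\binom{m}{k}(-1)^{m-k}x(t+k)$. At the integer endpoints $\alpha=2$ or $\beta=1$, the corresponding operator is the ordinary forward difference. Explicitly, with $\phi_\nu(m)=\frac{\Gamma(m+\nu)}{\Gamma(\nu)\Gamma(m+1)}$ for $\nu>0$, $m\in\mathbb{N}_0$, and $\phi_0(0)=1$, $\phi_0(m)=0$ for $m\ge1$, the equation (with $t=2-\alpha+n$) reads $$\sum_{s=0}^{n}\phi_{2-\alpha}(n-s)\Delta^2x(s)+a\sum_{s=0}^{n}\phi_{1-\beta}(n-s)\Delta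 x(s)=(b-1)x(n),\qquad n\in\mathbb{N}_0,$$ which determines $x(n)$, $n\ge2$, uniquely from $x(0),x(1)$. Asymptotic stability of the zero solution has its standard meaning with respect to the initial data $(x(0),x(1))$: it is stable and attractive, i.e. solutions tend to $0$ as $n\to\infty$. The stability region is the set of $b\in\mathbb{C}$ for which the zero solution is asymptotically stable. Winding number: for a closed curve $\eta:[0,2\pi]\to\mathbb{C}$ and $\lambda\notin\eta([0,2\pi])$, $\operatorname{Ind}_\eta(\lambda)=\frac{1}{2\pi\mathrm{i}}\int_0^{2\pi}\frac{\eta'(\theta)}{\eta(\theta)-\lambda}\,d\theta$. (For $\gamma$ above, $\gamma'$ may be unbounded at the endpoints but is integrable.) Convention: $0^{\alpha}=0^{\beta}=0$.
   Formalization: The boundary claim is corrected: the boundary of the stability region is shown to be the part of the curve γ lying in the closure of the region, since it need not be the whole curve (for α=2, β=1, a=5 the region is empty). *)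

theory Defs
  imports "HOL-Analysis.Analysis"
begin

(* Fractional operators take real times: Delta^{-nu} x lives on nu, nu + 1, ... although x lives
   on 0, 1, 2, ...; the real time t is decoded to the index n with t = nu + n by a floor. *)

definition time_set :: "real \<Rightarrow> real set" where
  "time_set r = {r + real n | n. True}"

definition fwd_diff :: "nat \<Rightarrow> (nat \<Rightarrow> complex) \<Rightarrow> nat \<Rightarrow> complex" where
  "fwd_diff m x n = (\<Sum>k\<le>m. of_nat (m choose k) * (-1) ^ (m - k) * x (n + k))"

definition frac_sum :: "real \<Rightarrow> (nat \<Rightarrow> complex) \<Rightarrow> real \<Rightarrow> complex" where
  "frac_sum \<nu> x t = (let n = nat \<lfloor>t - \<nu>\<rfloor> in
     of_real (1 / Gamma \<nu>) *
     (\<Sum>s\<le>n. of_real (Gamma (real n - real s + \<nu>) / Gamma (real n - real s + 1)) * x s))"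

(* For non-integer mu the integer m with m - 1 < mu < m is the ceiling of mu. *)
definition caputo_diff :: "real \<Rightarrow> (nat \<Rightarrow> complex) \<Rightarrow> real \<Rightarrow> complex" where
  "caputo_diff \<mu> x t =
     (if \<mu> \<in> \<int> then fwd_diff (nat \<lfloor>\<mu>\<rfloor>) x (nat \<lfloor>t\<rfloor>)
      else let m = nat \<lceil>\<mu>\<rceil> in frac_sum (real m - \<mu>) (fwd_diff m x) t)"

definition is_solution ::
  "real \<Rightarrow> real \<Rightarrow> real \<Rightarrow> complex \<Rightarrow> (nat \<Rightarrow> complex) \<Rightarrow> bool" where
  "is_solution \<alpha> \<beta> a b x \<longleftrightarrow>
     (\<forall>t \<in> time_set (2 - \<alpha>).
        caputo_diff \<alpha> x t + of_real a * caputo_diff \<beta> x (t + \<alpha> - \<beta> - 1)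
        = (b - 1) * x (nat \<lfloor>t + \<alpha> - 2\<rfloor>))"

definition zero_stable :: "real \<Rightarrow> real \<Rightarrow> real \<Rightarrow> complex \<Rightarrow> bool" where
  "zero_stable \<alpha> \<beta> a b \<longleftrightarrow>
     (\<forall>\<epsilon>>0. \<exists>\<delta>>0. \<forall>x. is_solution \<alpha> \<beta> a b x \<and> norm (x 0) < \<delta> \<and> norm (x 1) < \<delta>
        \<longrightarrow> (\<forall>n. norm (x n) < \<epsilon>))"

definition zero_attractive :: "real \<Rightarrow> real \<Rightarrow> real \<Rightarrow> complex \<Rightarrow> bool" where
  "zero_attractive \<alpha> \<beta> a b \<longleftrightarrow> (\<forall>x. is_solution \<alpha> \<beta> a b x \<longrightarrow> x \<longlonglongrightarrow> 0)"

definition zero_asymp_stable :: "real \<Rightarrow> real \<Rightarrow> real \<Rightarrow> complex \<Rightarrow> bool" where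
  "zero_asymp_stable \<alpha> \<beta> a b \<longleftrightarrow> zero_stable \<alpha> \<beta> a b \<and> zero_attractive \<alpha> \<beta> a b"

definition stability_region :: "real \<Rightarrow> real \<Rightarrow> real \<Rightarrow> complex set" where
  "stability_region \<alpha> \<beta> a = {b. zero_asymp_stable \<alpha> \<beta> a b}"

definition char_fun :: "real \<Rightarrow> real \<Rightarrow> real \<Rightarrow> complex \<Rightarrow> complex \<Rightarrow> complex" where
  "char_fun \<alpha> \<beta> a b z =
     z ^ 2 * (1 - inverse z) powr of_real \<alpha> + of_real a * z * (1 - inverse z) powr of_real \<beta> + 1 - b"

definition bd_curve :: "real \<Rightarrow> real \<Rightarrow> real \<Rightarrow> real \<Rightarrow> complex" where
  "bd_curve \<alpha> \<beta> a \<theta> =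
     of_real (2 powr \<alpha> * sin (\<theta> / 2) powr \<alpha>)
       * exp (\<i> * of_real (\<alpha> * pi / 2 + \<theta> * (2 - \<alpha> / 2)))
     + of_real (a * 2 powr \<beta> * sin (\<theta> / 2) powr \<beta>)
       * exp (\<i> * of_real (\<beta> * pi / 2 + \<theta> * (1 - \<beta> / 2)))
     + 1"

definition bd_curve1 :: "real \<Rightarrow> real \<Rightarrow> real \<Rightarrow> real \<Rightarrow> real" where
  "bd_curve1 \<alpha> \<beta> a \<theta> =
     2 powr \<alpha> * sin (\<theta> / 2) powr \<alpha> * cos (\<alpha> * pi / 2 + \<theta> * (2 - \<alpha> / 2))
     + a * 2 powr \<beta> * sin (\<theta> / 2) powr \<beta> * cos (\<beta> * pi / 2 + \<theta> * (1 - \<beta> / 2))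
     + 1"

definition bd_curve2 :: "real \<Rightarrow> real \<Rightarrow> real \<Rightarrow> real \<Rightarrow> real" where
  "bd_curve2 \<alpha> \<beta> a \<theta> =
     2 powr \<alpha> * sin (\<theta> / 2) powr \<alpha> * sin (\<alpha> * pi / 2 + \<theta> * (2 - \<alpha> / 2))
     + a * 2 powr \<beta> * sin (\<theta> / 2) powr \<beta> * sin (\<beta> * pi / 2 + \<theta> * (1 - \<beta> / 2))"

(* The library's winding_number is for paths on [0,1] and is defined through approximating
   polynomial paths; this is the integral itself, for curves on [0,2 pi].  The integrand may be
   unbounded at the endpoints. *)
definition curve_index :: "(real \<Rightarrow> complex) \<Rightarrow> complex \<Rightarrow> complex" where
  "curve_index \<eta> l =
     1 / (2 * of_real pi * \<i>) *
     integral {0..2 * pi} (\<lambda>\<theta>. vector_derivative \<eta> (at \<theta>) / (\<eta> \<theta> - l))"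

end

theory Submission
  imports Defs "HOL-Complex_Analysis.Complex_Analysis"
begin

text \<open>
  Put \<open>w = 1/z\<close> and \<open>P(w) = w\<^sup>2 D\<^sub>b(1/w) = (1 - w)\<^sup>\<alpha> + a w (1 - w)\<^sup>\<beta> + (1 - b) w\<^sup>2\<close>. The generating
  function of a solution is \<open>N/P\<close>, where \<open>N\<close> depends linearly on the initial data and has
  coefficients tending to \<open>0\<close>. The coefficients of \<open>P\<close> are absolutely summable. If \<open>P\<close> has no zero in
  the closed unit disc, then by Wiener's lemma \<open>1/P\<close> has absolutely summable coefficients as well, so
  the coefficients of \<open>N/P\<close> tend to \<open>0\<close>. If \<open>P(w\<^sub>0) = 0\<close> with \<open>w\<^sub>0 \<noteq> 1\<close> in the closed disc, the solution
  starting with \<open>0, 1\<close> does not tend to \<open>0\<close>: otherwise \<open>(1 - r) x(r w\<^sub>0) \<rightarrow> 0\<close> as \<open>r \<rightarrow> 1\<close> by Abel's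
  argument, while \<open>P(r w\<^sub>0) = O(1 - r)\<close>, contradicting \<open>x P = N\<close> and \<open>N(w\<^sub>0) \<noteq> 0\<close>; and \<open>w\<^sub>0 = 1\<close> means
  \<open>b = 1\<close>, where constants are solutions. Finally
  \<open>\<gamma>(\<theta>) - b = e\<^bsup>2i\<theta>\<^esup> P(e\<^bsup>-i\<theta>\<^esup>)\<close>, so by the argument principle the index of \<open>\<gamma>\<close> about \<open>b\<close> is \<open>2\<close> minus
  the number of zeros of \<open>P\<close> in the open disc.
\<close>

section \<open>Absolutely summable power series\<close>

definition abs_summable_fps :: "complex fps \<Rightarrow> bool" where
  "abs_summable_fps f \<longleftrightarrow> summable (\<lambda>n. norm (fps_nth f n))"

definition fps_l1_norm :: "complex fps \<Rightarrow> real" where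
  "fps_l1_norm f = (\<Sum>n. norm (fps_nth f n))"

lemma fps_l1_norm_nonneg: "abs_summable_fps f \<Longrightarrow> fps_l1_norm f \<ge> 0"
  unfolding abs_summable_fps_def fps_l1_norm_def by (intro suminf_nonneg) auto

lemma abs_summable_fps_finite:
  assumes "\<And>n. n \<ge> N \<Longrightarrow> fps_nth f n = 0"
  shows "abs_summable_fps f"
  unfolding abs_summable_fps_def
  by (rule summable_finite[of "{..<N}"]) (use assms in \<open>auto simp: not_less\<close>)

lemma abs_summable_fps_1: "abs_summable_fps 1"
  by (rule abs_summable_fps_finite[of 1]) auto

lemma abs_summable_fps_const: "abs_summable_fps (fps_const c)"
  by (rule abs_summable_fps_finite[of 1]) auto

lemma abs_summable_fps_X: "abs_summable_fps fps_X"
  by (rule abs_summable_fps_finite[of 2]) (auto simp: fps_X_def)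

lemma abs_summable_fps_add:
  assumes "abs_summable_fps f" "abs_summable_fps g"
  shows "abs_summable_fps (f + g)"
  unfolding abs_summable_fps_def
  by (rule summable_comparison_test[OF _ summable_add[OF assms[unfolded abs_summable_fps_def]]])
     (auto intro: norm_triangle_ineq)

lemma abs_summable_fps_diff:
  assumes "abs_summable_fps f" "abs_summable_fps g"
  shows "abs_summable_fps (f - g)"
  unfolding abs_summable_fps_def
  by (rule summable_comparison_test[OF _ summable_add[OF assms[unfolded abs_summable_fps_def]]])
     (auto intro: norm_triangle_ineq4)

lemma norm_fps_mult_nth_le:
  "norm (fps_nth (f * g) n) \<le> (\<Sum>i\<le>n. norm (fps_nth f i) * norm (fps_nth g (n - i)))"
  for f g :: "complex fps"
proof -
  have "norm (fps_nth (f * g) n) \<le> (\<Sum>i\<le>n. norm (fps_nth f i * fps_nth g (n - i)))"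
    unfolding fps_mult_nth atLeast0AtMost by (rule norm_sum)
  then show ?thesis by (simp add: norm_mult)
qed

lemma
  assumes "abs_summable_fps f" "abs_summable_fps g"
  shows abs_summable_fps_mult: "abs_summable_fps (f * g)"
    and fps_l1_norm_mult: "fps_l1_norm (f * g) \<le> fps_l1_norm f * fps_l1_norm g"
proof -
  let ?h = "\<lambda>n. \<Sum>i\<le>n. norm (fps_nth f i) * norm (fps_nth g (n - i))"
  have h: "?h sums (fps_l1_norm f * fps_l1_norm g)"
    unfolding fps_l1_norm_def using assms
    by (intro Cauchy_product_sums) (auto simp: abs_summable_fps_def)
  show s: "abs_summable_fps (f * g)"
    unfolding abs_summable_fps_def
    by (rule summable_comparison_test[OF _ sums_summable[OF h]]) (auto simp: norm_fps_mult_nth_le)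
  show "fps_l1_norm (f * g) \<le> fps_l1_norm f * fps_l1_norm g"
    unfolding sums_unique[OF h] unfolding fps_l1_norm_def
    by (intro suminf_le norm_fps_mult_nth_le sums_summable[OF h] s[unfolded abs_summable_fps_def])
qed

lemma abs_summable_fps_power: "abs_summable_fps f \<Longrightarrow> abs_summable_fps (f ^ n)"
  by (induction n) (auto intro: abs_summable_fps_mult abs_summable_fps_1)

lemma fps_l1_norm_power:
  assumes "abs_summable_fps f"
  shows "fps_l1_norm (f ^ n) \<le> fps_l1_norm f ^ n"
proof (induction n)
  case 0
  have "(\<Sum>n. norm (fps_nth (1::complex fps) n)) = (\<Sum>n\<in>{0}. norm (fps_nth (1::complex fps) n))"
    by (rule suminf_finite) auto
  then show ?case by (simp add: fps_l1_norm_def)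
next
  case (Suc n)
  have "fps_l1_norm (f ^ Suc n) \<le> fps_l1_norm f * fps_l1_norm (f ^ n)"
    using assms by (simp add: fps_l1_norm_mult abs_summable_fps_power)
  also have "\<dots> \<le> fps_l1_norm f * fps_l1_norm f ^ n"
    using Suc assms by (intro mult_left_mono fps_l1_norm_nonneg) auto
  finally show ?case by simp
qed

text \<open>Index pairs with \<open>i + j < n\<close> lie in the square of side \<open>n\<close>.
  Working with partial sums allows a \<open>g\<close> whose summability is still open, as needed for
  the Neumann series below.\<close>

lemma sum_norm_fps_mult_le:
  fixes f g :: "complex fps"
  assumes "abs_summable_fps f"
  shows "(\<Sum>k<n. norm (fps_nth (f * g) k)) \<le> fps_l1_norm f * (\<Sum>k<n. norm (fps_nth g k))"
proof -
  have "(\<Sum>k<n. norm (fps_nth (f * g) k))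
      \<le> (\<Sum>k<n. \<Sum>i\<le>k. norm (fps_nth f i) * norm (fps_nth g (k - i)))"
    by (intro sum_mono norm_fps_mult_nth_le)
  also have "\<dots> = (\<Sum>(i,j)\<in>{(i,j). i + j < n}. norm (fps_nth f i) * norm (fps_nth g j))"
    by (rule sum.triangle_reindex[symmetric])
  also have "\<dots> \<le> (\<Sum>(i,j)\<in>{..<n}\<times>{..<n}. norm (fps_nth f i) * norm (fps_nth g j))"
    by (rule sum_mono2) auto
  also have "\<dots> = (\<Sum>i<n. norm (fps_nth f i)) * (\<Sum>j<n. norm (fps_nth g j))"
    by (simp add: sum_product sum.cartesian_product)
  also have "\<dots> \<le> fps_l1_norm f * (\<Sum>k<n. norm (fps_nth g k))"
    unfolding fps_l1_norm_def using assms
    by (intro mult_right_mono sum_le_suminf sum_nonneg) (auto simp: abs_summable_fps_def)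
  finally show ?thesis .
qed

text \<open>Split the convolution at a fixed index \<open>N2\<close>. Below it, \<open>n - i\<close>
  is large and \<open>g\<close> is small there; from it on, \<open>f\<close> has a small tail while
  \<open>g\<close> stays bounded.\<close>

lemma fps_mult_tendsto_0:
  fixes f g :: "complex fps"
  assumes f: "abs_summable_fps f" and g: "(\<lambda>n. fps_nth g n) \<longlonglongrightarrow> 0"
  shows "(\<lambda>n. fps_nth (f * g) n) \<longlonglongrightarrow> 0"
proof (rule tendsto_norm_zero_cancel, rule LIMSEQ_I)
  fix e :: real
  assume e: "e > 0"
  define L where "L = fps_l1_norm f"
  have L: "L \<ge> 0" unfolding L_def using f by (rule fps_l1_norm_nonneg)
  obtain B where B: "B > 0" "\<And>n. norm (fps_nth g n) \<le> B"
    using convergent_imp_Bseq[OF convergentI[OF g]] by (auto elim: BseqE)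
  obtain N1 where N1: "\<And>n. n \<ge> N1 \<Longrightarrow> norm (fps_nth g n) < e / (2 * (L + 1))"
    using LIMSEQ_D[OF g, of "e / (2 * (L + 1))"] e L by auto
  obtain N2 where N2: "\<And>m n. m \<ge> N2 \<Longrightarrow> norm (\<Sum>k=m..<n. norm (fps_nth f k)) < e / (2 * B)"
    using f[unfolded abs_summable_fps_def summable_Cauchy] e B(1)
    by (metis divide_pos_pos mult_pos_pos zero_less_numeral)
  show "\<exists>no. \<forall>n\<ge>no. norm (norm (fps_nth (f * g) n) - 0) < e"
  proof (intro exI allI impI)
    fix n assume n: "n \<ge> N1 + N2"
    have split: "{..n} = {..<N2} \<union> {N2..<Suc n}" using n by auto
    have "norm (fps_nth (f * g) n) \<le> (\<Sum>i\<le>n. norm (fps_nth f i) * norm (fps_nth g (n - i)))"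
      by (rule norm_fps_mult_nth_le)
    also have "\<dots> = (\<Sum>i<N2. norm (fps_nth f i) * norm (fps_nth g (n - i)))
        + (\<Sum>i=N2..<Suc n. norm (fps_nth f i) * norm (fps_nth g (n - i)))"
      unfolding split by (rule sum.union_disjoint) auto
    also have "(\<Sum>i<N2. norm (fps_nth f i) * norm (fps_nth g (n - i)))
        \<le> (\<Sum>i<N2. norm (fps_nth f i) * (e / (2 * (L + 1))))"
      using n by (intro sum_mono mult_left_mono less_imp_le[OF N1]) auto
    also have "\<dots> = (\<Sum>i<N2. norm (fps_nth f i)) * (e / (2 * (L + 1)))"
      by (rule sum_distrib_right[symmetric])
    also have "\<dots> \<le> L * (e / (2 * (L + 1)))"
      unfolding L_def fps_l1_norm_def using f e L
      by (intro mult_right_mono sum_le_suminf) (auto simp: abs_summable_fps_def L_def fps_l1_norm_def)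
    also have "\<dots> \<le> e / 2" using e L by (simp add: field_simps)
    also have "(\<Sum>i=N2..<Suc n. norm (fps_nth f i) * norm (fps_nth g (n - i)))
        \<le> (\<Sum>i=N2..<Suc n. norm (fps_nth f i) * B)"
      by (intro sum_mono mult_left_mono B) auto
    also have "\<dots> = (\<Sum>i=N2..<Suc n. norm (fps_nth f i)) * B"
      by (rule sum_distrib_right[symmetric])
    also have "\<dots> < e / (2 * B) * B"
      using N2[of N2 "Suc n"] B by (intro mult_strict_right_mono) auto
    also have "\<dots> = e / 2" using B by simp
    finally show "norm (norm (fps_nth (f * g) n) - 0) < e" by simp
  qed
qed

text \<open>The inverse satisfies \<open>u = 1 + h * u\<close>, so each partial sum \<open>S\<close>
  of its norms obeys \<open>S \<le> 1 + fps_l1_norm h * S\<close>. This bounds all partial sums by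
  \<open>1 / (1 - fps_l1_norm h)\<close>.\<close>

lemma abs_summable_fps_inverse_one_minus:
  assumes h: "abs_summable_fps h" and less: "fps_l1_norm h < 1"
  shows "abs_summable_fps (inverse (1 - h))"
proof -
  define u where "u = inverse (1 - h)"
  have "norm (fps_nth h 0) \<le> fps_l1_norm h"
    using h sum_le_suminf[of "\<lambda>n. norm (fps_nth h n)" "{0}"]
    by (auto simp: abs_summable_fps_def fps_l1_norm_def)
  with less have "fps_nth (1 - h) 0 \<noteq> 0" by auto
  then have "u * (1 - h) = 1" unfolding u_def by (rule inverse_mult_eq_1)
  then have u: "u = 1 + h * u" by (simp add: algebra_simps)
  have bound: "(\<Sum>k<n. norm (fps_nth u k)) \<le> 1 / (1 - fps_l1_norm h)" for n
  proof -
    have "(\<Sum>k<n. norm (fps_nth u k)) \<le> (\<Sum>k<n. norm (fps_nth (1::complex fps) k) + norm (fps_nth (h * u) k))"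
      by (subst u, intro sum_mono) (simp add: norm_triangle_ineq del: fps_one_nth)
    also have "\<dots> = (\<Sum>k<n. norm (fps_nth (1::complex fps) k)) + (\<Sum>k<n. norm (fps_nth (h * u) k))"
      by (simp add: sum.distrib)
    also have "(\<Sum>k<n. norm (fps_nth (1::complex fps) k)) \<le> 1"
      by (cases n) (simp_all add: sum.lessThan_Suc_shift del: sum.lessThan_Suc)
    also have "(\<Sum>k<n. norm (fps_nth (h * u) k)) \<le> fps_l1_norm h * (\<Sum>k<n. norm (fps_nth u k))"
      by (rule sum_norm_fps_mult_le[OF h])
    finally show ?thesis using less by (simp add: field_simps)
  qed
  show ?thesis
    unfolding abs_summable_fps_def u_def[symmetric]
    by (rule bounded_imp_summable[where B = "1 / (1 - fps_l1_norm h)"])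
       (use bound[of "Suc n" for n] in \<open>auto simp: lessThan_Suc_atMost\<close>)
qed

section \<open>Wiener's lemma for power series\<close>

lemma fps_conv_radius_ge_1_if_bounded:
  fixes f :: "complex fps"
  assumes "\<And>n. norm (fps_nth f n) \<le> B"
  shows "fps_conv_radius f \<ge> 1"
  unfolding fps_conv_radius_def
proof (rule conv_radius_geI_ex)
  fix r :: real
  assume r: "0 < r" "ereal r < 1"
  have "summable (\<lambda>n. fps_nth f n * of_real r ^ n)"
  proof (rule summable_comparison_test)
    show "\<exists>N. \<forall>n\<ge>N. norm (fps_nth f n * complex_of_real r ^ n) \<le> B * r ^ n"
      using assms r by (auto simp: norm_mult norm_power intro!: mult_right_mono)
    show "summable (\<lambda>n. B * r ^ n)" using r by (intro summable_mult summable_geometric) auto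
  qed
  then show "\<exists>z::complex. norm z = r \<and> summable (\<lambda>n. fps_nth f n * z ^ n)"
    using r by (intro exI[of _ "of_real r"]) auto
qed

lemma abs_summable_fps_conv_radius:
  assumes "abs_summable_fps f"
  shows "fps_conv_radius f \<ge> 1"
proof -
  have "Bseq (\<lambda>n. fps_nth f n)"
    using assms unfolding abs_summable_fps_def
    by (rule summable_norm_cancel[THEN summable_LIMSEQ_zero, THEN convergentI, THEN convergent_imp_Bseq])
  then show ?thesis by (auto elim!: BseqE intro: fps_conv_radius_ge_1_if_bounded)
qed

text \<open>Cauchy's inequality on the circle of radius \<open>r < 1\<close>, followed by
  \<open>r\<close> tending to \<open>1\<close>; boundary values of \<open>G\<close> never
  enter.\<close>

lemma norm_fps_nth_le_if_bounded:
  fixes F :: "complex fps"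
  assumes G: "G has_fps_expansion F" "G holomorphic_on ball 0 1"
    and B: "\<And>w. norm w < 1 \<Longrightarrow> norm (G w) \<le> B"
  shows "norm (fps_nth F k) \<le> B"
proof -
  have *: "norm (fps_nth F k) * r ^ k \<le> B" if r: "0 < r" "r < 1" for r :: real
  proof -
    have "norm ((deriv ^^ k) G 0) \<le> fact k * B / r ^ k"
    proof (rule Cauchy_inequality)
      show "G holomorphic_on ball 0 r"
        using G(2) by (rule holomorphic_on_subset) (use r in auto)
      show "continuous_on (cball 0 r) G"
        using G(2) r by (intro holomorphic_on_imp_continuous_on holomorphic_on_subset[OF G(2)]) auto
    qed (use r B in auto)
    then show ?thesis
      using r by (simp add: fps_nth_fps_expansion[OF G(1)] norm_divide field_simps)
  qed
  have "((\<lambda>r. norm (fps_nth F k) * r ^ k) \<longlongrightarrow> norm (fps_nth F k) * 1 ^ k) (at_left 1)"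
    by (intro tendsto_intros)
  moreover have "\<forall>\<^sub>F r in at_left (1::real). norm (fps_nth F k) * r ^ k \<le> B"
  proof -
    have "\<forall>\<^sub>F r in at_left (1::real). r \<in> {0<..<1}"
      by (rule eventually_at_left_real) auto
    then show ?thesis by eventually_elim (use * in auto)
  qed
  ultimately show ?thesis
    using tendsto_upperbound[of _ _ "at_left (1::real)" B] by force
qed

text \<open>
  Compare \<open>f\<close> with its dilation \<open>f(rX)\<close>, \<open>r < 1\<close>. By Cauchy's inequality the coefficients of \<open>f\<^bsup>-n\<^esup>\<close> are
  at most \<open>m\<^bsup>-n\<^esup>\<close>, so those of \<open>f(rX)\<^bsup>-n\<^esup>\<close> have sum at most \<open>m\<^bsup>-n\<^esup>/(1 - r)\<close>. For \<open>r\<close> close to \<open>1\<close> the difference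
  \<open>d = f(rX) - f\<close> has norm at most \<open>m/2\<close>, hence \<open>q = d/f(rX)\<close> has a power of norm less than \<open>1\<close>, and
  \<open>f = f(rX) (1 - q)\<close> can be inverted by a Neumann series.
\<close>

theorem Wiener_abs_summable_fps_inverse:
  assumes f: "abs_summable_fps f" and m: "m > 0"
    and bound: "\<And>w. norm w < 1 \<Longrightarrow> m \<le> norm (eval_fps f w)"
  shows "abs_summable_fps (inverse f)"
proof -
  have hol: "eval_fps f holomorphic_on ball 0 1"
    using abs_summable_fps_conv_radius[OF f] by (intro holomorphic_on_eval_fps) (metis ball_eball_mono one_ereal_def)
  have exp: "eval_fps f has_fps_expansion f"
    by (rule eval_fps_has_fps_expansion, rule less_le_trans[of 0 1])
       (use abs_summable_fps_conv_radius[OF f] in auto)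
  have f0: "fps_nth f 0 \<noteq> 0"
    using bound[of 0] m by (auto simp: eval_fps_at_0)
  have nz: "eval_fps f w \<noteq> 0" if "norm w < 1" for w
    using bound[OF that] m by auto
  have inv_exp: "(\<lambda>w. inverse (eval_fps f w) ^ n) has_fps_expansion inverse f ^ n" for n
    by (induction n) (auto intro!: has_fps_expansion_mult has_fps_expansion_inverse exp f0)
  have coeff: "norm (fps_nth (inverse f ^ n) k) \<le> (1 / m) ^ n" for n k
  proof (rule norm_fps_nth_le_if_bounded[OF inv_exp])
    show "(\<lambda>w. inverse (eval_fps f w) ^ n) holomorphic_on ball 0 1"
      by (intro holomorphic_intros hol) (auto simp: nz)
  next
    fix w :: complex assume "norm w < 1"
    then have "inverse (norm (eval_fps f w)) \<le> 1 / m"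
      using bound[of w] m by (simp add: divide_inverse le_imp_inverse_le)
    then show "norm (inverse (eval_fps f w) ^ n) \<le> (1 / m) ^ n"
      by (auto simp: norm_power norm_inverse intro!: power_mono)
  qed
  \<comment> \<open>Writing the dilation as a composition with \<open>r X\<close> makes it a ring
    homomorphism, so it commutes with powers and inverses.\<close>
  define dil where "dil = (\<lambda>(r::real) (g::complex fps). g oo (fps_const (of_real r) * fps_X))"
  have dil_nth: "fps_nth (dil r g) n = of_real r ^ n * fps_nth g n" for r g n
    by (simp add: dil_def fps_compose_linear)
  have dil_mult: "dil r (g * h) = dil r g * dil r h" for r g h
    unfolding dil_def by (rule fps_compose_mult_distrib) simp
  have dil_power: "dil r (g ^ n) = dil r g ^ n" for r g n
    unfolding dil_def by (rule fps_compose_power[symmetric]) simp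
  have dil_1: "dil r 1 = 1" for r unfolding dil_def by simp
  have dil_summable: "abs_summable_fps (dil r g)"
    if "0 < r" "r < 1" "\<And>k. norm (fps_nth g k) \<le> B" for r g B
    unfolding abs_summable_fps_def
    by (rule summable_comparison_test[of _ "\<lambda>k. r ^ k * B"])
       (use that in \<open>auto simp: dil_nth norm_mult norm_power intro!: mult_left_mono summable_mult2 summable_geometric\<close>)
  have dil_norm: "fps_l1_norm (dil r g) \<le> B / (1 - r)"
    if "0 < r" "r < 1" "\<And>k. norm (fps_nth g k) \<le> B" for r g B
  proof -
    have "fps_l1_norm (dil r g) \<le> (\<Sum>k. r ^ k * B)"
      unfolding fps_l1_norm_def using dil_summable[OF that] that
      by (intro suminf_le)
         (auto simp: abs_summable_fps_def dil_nth norm_mult norm_power intro!: mult_left_mono summable_mult2 summable_geometric)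
    also have "\<dots> = (\<Sum>k. r ^ k) * B"
      using that by (intro suminf_mult2[symmetric] summable_geometric) auto
    also have "\<dots> = B / (1 - r)" using that by (simp add: suminf_geometric)
    finally show ?thesis .
  qed
  \<comment> \<open>The bound \<open>m / 2\<close> for \<open>dil r f - f\<close> is split in two.
    The tail beyond \<open>N\<close> costs less than \<open>m / 4\<close> for every
    \<open>r\<close>, since \<open>1 - r ^ k\<close> is at most \<open>1\<close>; the finitely many
    terms before \<open>N\<close> fall below \<open>m / 4\<close> for \<open>r\<close> near
    \<open>1\<close>.\<close>
  obtain N where N: "(\<Sum>k. norm (fps_nth f (k + N))) < m / 4"
  proof -
    have "(\<lambda>N. \<Sum>k. norm (fps_nth f (k + N))) \<longlonglongrightarrow> 0"
      using f unfolding abs_summable_fps_def by (rule suminf_exist_split2)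
    from LIMSEQ_D[OF this, of "m / 4"] m obtain N where
      "norm (\<Sum>k. norm (fps_nth f (k + N))) < m / 4" by auto
    then show thesis by (intro that[of N]) (simp add: abs_less_iff)
  qed
  have dil_diff_le: "norm (fps_nth (dil r f - f) k) \<le> norm (fps_nth f k)" if "0 < r" "r < 1" for r k
  proof -
    have "fps_nth (dil r f - f) k = - of_real (1 - r ^ k) * fps_nth f k"
      by (simp add: dil_nth algebra_simps)
    moreover have "\<bar>1 - r ^ k\<bar> \<le> 1" using that power_le_one[of r k] by auto
    ultimately show ?thesis
      by (simp only: norm_mult norm_minus_cancel norm_of_real) (simp add: mult_left_le_one_le)
  qed
  have "\<forall>\<^sub>F r in at_left (1::real). (\<Sum>k<N. norm (fps_nth (dil r f - f) k)) < m / 4"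
  proof -
    have "((\<lambda>r. \<Sum>k<N. norm (of_real r ^ k * fps_nth f k - fps_nth f k)) \<longlongrightarrow>
        (\<Sum>k<N. norm (of_real 1 ^ k * fps_nth f k - fps_nth f k))) (at_left 1)"
      by (intro tendsto_intros)
    then show ?thesis
      unfolding fps_sub_nth dil_nth using m by (intro order_tendstoD(2)) auto
  qed
  moreover have "\<forall>\<^sub>F r in at_left (1::real). r \<in> {0<..<1}"
    by (rule eventually_at_left_real) auto
  ultimately have "\<forall>\<^sub>F r in at_left (1::real). r \<in> {0<..<1} \<and>
      (\<Sum>k<N. norm (fps_nth (dil r f - f) k)) < m / 4"
    by eventually_elim auto
  then obtain r where r: "0 < r" "r < 1" "(\<Sum>k<N. norm (fps_nth (dil r f - f) k)) < m / 4"
    using eventually_happens[of _ "at_left (1::real)"] by (auto simp: trivial_limit_at_left_real)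
  define d where "d = dil r f - f"
  have d_le: "norm (fps_nth d k) \<le> norm (fps_nth f k)" for k
    unfolding d_def by (rule dil_diff_le) (use r in auto)
  have d: "abs_summable_fps d"
    unfolding abs_summable_fps_def
    by (rule summable_comparison_test[OF _ f[unfolded abs_summable_fps_def]]) (use d_le in auto)
  have d_norm: "fps_l1_norm d \<le> m / 2"
  proof -
    have "(\<Sum>k. norm (fps_nth d (k + N))) \<le> (\<Sum>k. norm (fps_nth f (k + N)))"
      using d f unfolding abs_summable_fps_def
      by (intro suminf_le d_le summable_ignore_initial_segment[where f="\<lambda>n. norm (fps_nth d n)"]
           summable_ignore_initial_segment[where f="\<lambda>n. norm (fps_nth f n)"]) auto
    moreover have "fps_l1_norm d = (\<Sum>k. norm (fps_nth d (k + N))) + (\<Sum>k<N. norm (fps_nth d k))"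
      unfolding fps_l1_norm_def using d unfolding abs_summable_fps_def
      by (rule suminf_split_initial_segment)
    ultimately show ?thesis using N r(3) unfolding d_def by simp
  qed
  \<comment> \<open>\<open>p\<close> is the inverse of \<open>dil r f\<close>. Its own norm may be
    large, but the bound for \<open>p ^ n\<close> contains the factor \<open>1 / (1 - r)\<close>
    only once, whatever \<open>n\<close> is.\<close>
  define p where "p = dil r (inverse f)"
  have p_norm: "abs_summable_fps (p ^ n)" "fps_l1_norm (p ^ n) \<le> (1 / m) ^ n / (1 - r)" for n
    unfolding p_def dil_power[symmetric]
    by (rule dil_summable[OF r(1,2) coeff] dil_norm[OF r(1,2) coeff])+
  have p_inv: "p * dil r f = 1"
    unfolding p_def dil_mult[symmetric] using f0 by (simp add: inverse_mult_eq_1 dil_1)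
  define q where "q = p * d"
  have q: "abs_summable_fps q"
    unfolding q_def using p_norm(1)[of 1] d by (auto intro: abs_summable_fps_mult)
  \<comment> \<open>The factors \<open>(1 / m) ^ n\<close> and \<open>(m / 2) ^ n\<close> leave
    \<open>(1 / 2) ^ n\<close>, which beats the constant \<open>1 / (1 - r)\<close> because
    \<open>r\<close> is now fixed.\<close>
  have q_norm: "fps_l1_norm (q ^ n) \<le> (1 / 2) ^ n / (1 - r)" for n
  proof -
    have "fps_l1_norm (q ^ n) \<le> fps_l1_norm (p ^ n) * fps_l1_norm (d ^ n)"
      unfolding q_def power_mult_distrib by (intro fps_l1_norm_mult p_norm abs_summable_fps_power d)
    also have "\<dots> \<le> (1 / m) ^ n / (1 - r) * (m / 2) ^ n"
    proof (intro mult_mono p_norm fps_l1_norm_nonneg abs_summable_fps_power d)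
      show "fps_l1_norm (d ^ n) \<le> (m / 2) ^ n"
        using fps_l1_norm_power[OF d, of n] power_mono[OF d_norm fps_l1_norm_nonneg[OF d], of n]
        by simp
    qed (use r m in auto)
    also have "\<dots> = (1 / 2) ^ n / (1 - r)" using m by (simp add: power_divide)
    finally show ?thesis .
  qed
  have "(\<lambda>n. (1 / 2) ^ n / (1 - r)) \<longlonglongrightarrow> 0 / (1 - r)"
    by (intro tendsto_divide LIMSEQ_power_zero) (use r in auto)
  then have "\<forall>\<^sub>F n in sequentially. (1 / 2) ^ n / (1 - r) < 1"
    by (intro order_tendstoD(2)) auto
  then obtain n where "(1 / 2) ^ n / (1 - r) < 1"
    by (meson eventually_happens sequentially_bot)
  with q_norm[of n] have n: "fps_l1_norm (q ^ n) < 1" by simp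
  have inv: "abs_summable_fps (inverse (1 - q ^ n))"
    by (intro abs_summable_fps_inverse_one_minus abs_summable_fps_power q n)
  have q0: "fps_nth (1 - q ^ n) 0 \<noteq> 0"
  proof
    assume 0: "fps_nth (1 - q ^ n) 0 = 0"
    have "norm (fps_nth (q ^ n) 0) \<le> fps_l1_norm (q ^ n)"
      using abs_summable_fps_power[OF q, of n] sum_le_suminf[of "\<lambda>k. norm (fps_nth (q ^ n) k)" "{0}"]
      by (auto simp: abs_summable_fps_def fps_l1_norm_def)
    with 0 n show False by (auto simp: fps_power_zeroth simp flip: power_eq_iff_eq_base)
  qed
  \<comment> \<open>Only \<open>q ^ n\<close> is known to have norm below \<open>1\<close>, so
    \<open>1 - q\<close> is inverted through its multiple \<open>1 - q ^ n\<close>.\<close>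
  have "p * f = 1 - q"
    using p_inv unfolding q_def d_def by (simp add: algebra_simps)
  moreover have "1 - q ^ n = (1 - q) * (\<Sum>i<n. q ^ i)"
    by (rule one_diff_power_eq)
  ultimately have "1 - q ^ n = f * (p * (\<Sum>i<n. q ^ i))"
    by (simp add: mult_ac)
  then have "f * (p * (\<Sum>i<n. q ^ i) * inverse (1 - q ^ n)) = 1"
    using q0 by (metis inverse_mult_eq_1' mult.assoc)
  then have "inverse f = p * (\<Sum>i<n. q ^ i) * inverse (1 - q ^ n)"
    by (rule fps_inverse_unique)
  moreover have "abs_summable_fps (\<Sum>i<k. q ^ i)" for k
  proof (induction k)
    case 0
    then show ?case by (simp add: abs_summable_fps_def)
  qed (auto intro!: abs_summable_fps_add abs_summable_fps_power q)
  ultimately show ?thesis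
    using p_norm(1)[of 1] inv by (auto intro!: abs_summable_fps_mult)
qed

section \<open>Generating functions of solutions\<close>

definition one_minus_X_powr :: "real \<Rightarrow> complex fps" where
  "one_minus_X_powr c = fps_binomial (of_real c) oo (- fps_X)"

lemma one_minus_X_powr_nth:
  "fps_nth (one_minus_X_powr c) n = (-1) ^ n * (complex_of_real c gchoose n)"
  by (simp add: one_minus_X_powr_def fps_compose_uminus')

text \<open>For \<open>\<nu> > 0\<close> these are the kernel values
  \<open>Gamma (n + \<nu>) / (Gamma \<nu> * Gamma (n + 1))\<close> of the fractional sum.\<close>

lemma one_minus_X_powr_nth_pochhammer:
  "fps_nth (one_minus_X_powr (- \<nu>)) n = of_real (pochhammer \<nu> n / fact n)"
proof -
  have "fps_nth (one_minus_X_powr (- \<nu>)) n = ((-1) ^ n * (-1) ^ n) * (pochhammer (of_real \<nu>) n / fact n)"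
    by (simp add: one_minus_X_powr_nth gbinomial_pochhammer)
  also have "(-1) ^ n * (-1) ^ n = (1 :: complex)" by (simp flip: power_mult_distrib)
  finally show ?thesis by (simp add: pochhammer_of_real)
qed

lemma one_minus_X_powr_add: "one_minus_X_powr (c + d) = one_minus_X_powr c * one_minus_X_powr d"
  by (simp add: one_minus_X_powr_def fps_binomial_add_mult fps_compose_mult_distrib)

lemma one_minus_X_powr_0 [simp]: "one_minus_X_powr 0 = 1"
  by (simp add: one_minus_X_powr_def)

lemma one_minus_X_powr_1: "one_minus_X_powr 1 = 1 - fps_X"
  by (simp add: one_minus_X_powr_def fps_binomial_1 fps_compose_add_distrib)

lemma one_minus_X_powr_add_1: "one_minus_X_powr (c + 1) = one_minus_X_powr c * (1 - fps_X)"
  by (simp add: one_minus_X_powr_add one_minus_X_powr_1)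

lemma one_minus_X_powr_sums:
  assumes "norm w < 1"
  shows "(\<lambda>n. fps_nth (one_minus_X_powr c) n * w ^ n) sums (1 - w) powr of_real c"
  using gen_binomial_complex[of "- w" "of_real c"] assms
  by (simp add: one_minus_X_powr_nth power_minus[of w] mult_ac)

lemma eval_one_minus_X_powr:
  "norm w < 1 \<Longrightarrow> eval_fps (one_minus_X_powr c) w = (1 - w) powr of_real c"
  unfolding eval_fps_def by (rule sums_unique[OF one_minus_X_powr_sums, symmetric])

lemma one_minus_X_powr_conv_radius: "fps_conv_radius (one_minus_X_powr c) \<ge> 1"
  unfolding fps_conv_radius_def
proof (rule conv_radius_geI_ex)
  fix r :: real assume r: "0 < r" "ereal r < 1"
  then show "\<exists>z::complex. norm z = r \<and> summable (\<lambda>n. fps_nth (one_minus_X_powr c) n * z ^ n)"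
    using sums_summable[OF one_minus_X_powr_sums[of "of_real r" c]]
    by (intro exI[of _ "of_real r"]) auto
qed

text \<open>The binomial coefficient divided by \<open>(-1) ^ n * n powr (- (c + 1))\<close>
  converges. Only boundedness of this quotient is used, so it is harmless that the limit is
  \<open>0\<close> when \<open>c\<close> is a nonnegative integer.\<close>

lemma one_minus_X_powr_bigo:
  "(\<lambda>n. norm (fps_nth (one_minus_X_powr c) n)) \<in> O(\<lambda>n. real n powr (- (c + 1)))"
proof -
  obtain K where K: "\<And>n. norm ((complex_of_real c gchoose n) /
      ((-1) ^ n / exp ((complex_of_real c + 1) * of_real (ln (real n))))) \<le> K"
    using convergent_imp_Bseq[OF convergentI[OF gbinomial_asymptotic[of "complex_of_real c"]]]
    unfolding Bseq_def by blast
  show ?thesis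
  proof (rule bigoI[where c = K])
    show "\<forall>\<^sub>F n in sequentially. norm (norm (fps_nth (one_minus_X_powr c) n)) \<le> K * norm (real n powr (- (c + 1)))"
      using eventually_gt_at_top[of 0]
    proof eventually_elim
      case (elim n)
      have "norm (exp ((complex_of_real c + 1) * of_real (ln (real n)))) = real n powr (c + 1)"
        using elim by (simp add: powr_def)
      with K[of n] have "norm (complex_of_real c gchoose n) * real n powr (c + 1) \<le> K"
        by (simp add: norm_mult norm_divide norm_power)
      moreover have "real n powr (- (c + 1)) = 1 / real n powr (c + 1)"
        by (rule powr_minus_divide)
      ultimately show ?case using elim
        by (simp add: one_minus_X_powr_nth norm_mult norm_power pos_le_divide_eq)
    qed
  qed
qed

lemma abs_summable_one_minus_X_powr:
  assumes "c > 0"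
  shows "abs_summable_fps (one_minus_X_powr c)"
  unfolding abs_summable_fps_def
proof (rule summable_comparison_test_bigo)
  show "summable (\<lambda>n. norm (real n powr (- (c + 1))))"
    using assms by (simp add: summable_real_powr_iff)
qed (use one_minus_X_powr_bigo[of c] in simp)

text \<open>The range \<open>c > -1\<close> covers the exponents \<open>\<alpha> - 2\<close> and
  \<open>\<beta> - 1\<close> coming from the initial data, where absolute summability fails in
  general.\<close>

lemma one_minus_X_powr_tendsto_0:
  assumes "c > -1"
  shows "(\<lambda>n. fps_nth (one_minus_X_powr c) n) \<longlonglongrightarrow> 0"
proof -
  have "(\<lambda>n. real n powr (- (c + 1))) \<longlonglongrightarrow> 0"
    using assms by (intro tendsto_neg_powr filterlim_real_sequentially) auto
  then have "(\<lambda>n. real n powr (- (c + 1))) \<in> o(\<lambda>_. 1)"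
    by (intro smalloI_tendsto) auto
  with one_minus_X_powr_bigo[of c] have "(\<lambda>n. norm (fps_nth (one_minus_X_powr c) n)) \<in> o(\<lambda>_. 1 :: real)"
    by (rule landau_o.big_small_trans)
  then have "(\<lambda>n. norm (fps_nth (one_minus_X_powr c) n)) \<longlonglongrightarrow> 0"
    by (auto dest: smalloD_tendsto)
  then show ?thesis by (rule tendsto_norm_zero_cancel)
qed

section \<open>Fractional operators as Cauchy products\<close>

lemma frac_sum_eq_fps_mult:
  assumes "\<nu> > 0"
  shows "frac_sum \<nu> y (\<nu> + real n) = fps_nth (one_minus_X_powr (- \<nu>) * Abs_fps y) n"
proof -
  have coeff: "of_real (1 / Gamma \<nu>) * of_real (Gamma (real n - real s + \<nu>) / Gamma (real n - real s + 1))
      = fps_nth (one_minus_X_powr (- \<nu>)) (n - s)" if "s \<le> n" for s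
  proof -
    have "\<nu> \<notin> \<int>\<^sub>\<le>\<^sub>0" using assms by (auto elim!: nonpos_Ints_cases)
    moreover have "Gamma (real n - real s + 1) = fact (n - s)"
      using that Gamma_fact[of "n - s", where 'a = real] by (simp add: of_nat_diff add_ac)
    ultimately show ?thesis
      using that by (simp add: one_minus_X_powr_nth_pochhammer pochhammer_Gamma of_nat_diff add_ac)
  qed
  have "frac_sum \<nu> y (\<nu> + real n)
      = (\<Sum>s\<le>n. (of_real (1 / Gamma \<nu>) * of_real (Gamma (real n - real s + \<nu>) / Gamma (real n - real s + 1))) * y s)"
    by (simp add: frac_sum_def sum_distrib_left mult.assoc)
  also have "\<dots> = (\<Sum>s\<le>n. fps_nth (one_minus_X_powr (- \<nu>)) (n - s) * y s)"
    using coeff by (intro sum.cong) auto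
  also have "\<dots> = (\<Sum>s\<le>n. y s * fps_nth (one_minus_X_powr (- \<nu>)) (n - s))"
    by (simp add: mult.commute)
  also have "\<dots> = fps_nth (Abs_fps y * one_minus_X_powr (- \<nu>)) n"
    by (simp add: fps_mult_nth atLeast0AtMost)
  finally show ?thesis by (simp add: mult.commute)
qed

text \<open>At the integer end point \<open>\<mu> = m\<close> the kernel
  \<open>one_minus_X_powr 0\<close> is \<open>1\<close> and the ordinary difference results, so one
  formula serves both branches of \<open>caputo_diff\<close>.\<close>

lemma caputo_diff_eq_fps_mult:
  assumes "real m - 1 < \<mu>" "\<mu> \<le> real m"
  shows "caputo_diff \<mu> x (real m - \<mu> + real n)
    = fps_nth (one_minus_X_powr (\<mu> - real m) * Abs_fps (fwd_diff m x)) n"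
proof (cases "\<mu> = real m")
  case True
  then show ?thesis by (simp add: caputo_diff_def)
next
  case False
  with assms have "\<lceil>\<mu>\<rceil> = int m" by linarith
  moreover have "\<mu> \<notin> \<int>"
  proof
    assume "\<mu> \<in> \<int>"
    then obtain k where "\<mu> = of_int k" by (auto elim: Ints_cases)
    then have "real_of_int (int m - 1) < real_of_int k" "real_of_int k < real_of_int (int m)"
      using assms False by auto
    then show False unfolding of_int_less_iff by linarith
  qed
  ultimately show ?thesis
    using frac_sum_eq_fps_mult[of "real m - \<mu>" "fwd_diff m x" n] assms False
    by (simp add: caputo_diff_def)
qed

definition char_fps :: "real \<Rightarrow> real \<Rightarrow> real \<Rightarrow> complex \<Rightarrow> complex fps" where
  "char_fps \<alpha> \<beta> a b = one_minus_X_powr \<alpha> + fps_const (of_real a) * fps_X * one_minus_X_powr \<beta>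
     + fps_const (1 - b) * fps_X ^ 2"

text \<open>The numerator \<open>N\<close>: the initial terms split off when \<open>X^2\<close>
  times the generating function of the equation is expressed through that of \<open>x\<close>. The
  first summand stems from the second difference, the other from the first difference.\<close>

definition init_fps :: "real \<Rightarrow> real \<Rightarrow> real \<Rightarrow> complex \<Rightarrow> complex \<Rightarrow> complex fps" where
  "init_fps \<alpha> \<beta> a x0 x1 = one_minus_X_powr (\<alpha> - 2) * (fps_const x0 * (1 - 2 * fps_X) + fps_const x1 * fps_X)
     + fps_const (of_real a * x0) * fps_X * one_minus_X_powr (\<beta> - 1)"

lemma fps_X_mult_fwd_diff_1:
  "fps_X * Abs_fps (fwd_diff 1 x) = (1 - fps_X) * Abs_fps x - fps_const (x 0)"
proof (rule fps_ext)
  fix n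
  have "(1 - fps_X) * Abs_fps x = Abs_fps x - fps_X * Abs_fps x" by (simp add: algebra_simps)
  then show "fps_nth (fps_X * Abs_fps (fwd_diff 1 x)) n = fps_nth ((1 - fps_X) * Abs_fps x - fps_const (x 0)) n"
    by (cases n) (simp_all add: fwd_diff_def)
qed

lemma fps_X2_mult_fwd_diff_2:
  "fps_X ^ 2 * Abs_fps (fwd_diff 2 x)
    = (1 - fps_X) ^ 2 * Abs_fps x - fps_const (x 0) * (1 - 2 * fps_X) - fps_const (x 1) * fps_X"
proof (rule fps_ext)
  fix n
  have 1: "(1 - fps_X) ^ 2 * Abs_fps x = Abs_fps x - fps_const 2 * (fps_X * Abs_fps x) + fps_X * (fps_X * Abs_fps x)"
    by (simp add: power2_eq_square algebra_simps flip: numeral_fps_const)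
  have 2: "fps_X ^ 2 * Abs_fps (fwd_diff 2 x) = fps_X * (fps_X * Abs_fps (fwd_diff 2 x))"
    by (simp add: power2_eq_square mult.assoc)
  have 3: "fps_const (x 0) * (1 - 2 * fps_X) = fps_const (x 0) - fps_const (2 * x 0) * fps_X"
    by (simp add: fps_eq_iff algebra_simps numeral_fps_const)
  have fwd: "fwd_diff 2 x k = x k - 2 * x (Suc k) + x (Suc (Suc k))" for k
    by (simp add: fwd_diff_def numeral_2_eq_2)
  consider "n = 0" | "n = 1" | k where "n = Suc (Suc k)"
    by (metis One_nat_def not0_implies_Suc)
  then show "fps_nth (fps_X ^ 2 * Abs_fps (fwd_diff 2 x)) n = fps_nth ((1 - fps_X) ^ 2 * Abs_fps x
      - fps_const (x 0) * (1 - 2 * fps_X) - fps_const (x 1) * fps_X) n"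
    unfolding 1 2 3 by cases (simp_all add: fwd)
qed

text \<open>Take generating functions and multiply by \<open>X^2\<close>, which is reversible in an
  integral domain. Each difference of order \<open>m\<close> then yields a factor
  \<open>(1 - X)^m\<close> and initial terms, and that factor raises the kernel exponents
  \<open>\<alpha> - 2\<close> and \<open>\<beta> - 1\<close> to \<open>\<alpha>\<close> and
  \<open>\<beta>\<close>.\<close>

lemma is_solution_iff_fps:
  assumes "0 < \<beta>" "\<beta> \<le> 1" "1 < \<alpha>" "\<alpha> \<le> 2"
  shows "is_solution \<alpha> \<beta> a b x \<longleftrightarrow> Abs_fps x * char_fps \<alpha> \<beta> a b = init_fps \<alpha> \<beta> a (x 0) (x 1)"
proof -
  let ?X = "Abs_fps x"
  let ?A = "one_minus_X_powr (\<alpha> - 2)" and ?B = "one_minus_X_powr (\<beta> - 1)"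
  let ?L = "?A * Abs_fps (fwd_diff 2 x) + fps_const (of_real a) * (?B * Abs_fps (fwd_diff 1 x))"
  have "is_solution \<alpha> \<beta> a b x \<longleftrightarrow>
     (\<forall>n. caputo_diff \<alpha> x (2 - \<alpha> + real n) + of_real a * caputo_diff \<beta> x (1 - \<beta> + real n) = (b - 1) * x n)"
  proof -
    have "2 - \<alpha> + real n + \<alpha> - \<beta> - 1 = 1 - \<beta> + real n" "nat \<lfloor>2 - \<alpha> + real n + \<alpha> - 2\<rfloor> = n" for n
      by (simp_all add: algebra_simps)
    moreover have "(\<forall>t\<in>time_set r. Q t) \<longleftrightarrow> (\<forall>n. Q (r + real n))" for r Q
      by (auto simp: time_set_def)
    ultimately show ?thesis unfolding is_solution_def by (simp only:)
  qed
  also have "\<dots> \<longleftrightarrow> (\<forall>n. fps_nth ?L n = fps_nth (fps_const (b - 1) * ?X) n)"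
    using caputo_diff_eq_fps_mult[of 2 \<alpha> x] caputo_diff_eq_fps_mult[of 1 \<beta> x] assms by simp
  also have "\<dots> \<longleftrightarrow> ?L = fps_const (b - 1) * ?X"
    by (simp add: fps_eq_iff)
  also have "\<dots> \<longleftrightarrow> fps_X ^ 2 * ?L = fps_X ^ 2 * (fps_const (b - 1) * ?X)"
    by simp
  also have "fps_X ^ 2 * ?L = ?A * (fps_X ^ 2 * Abs_fps (fwd_diff 2 x))
      + fps_const (of_real a) * (fps_X * (?B * (fps_X * Abs_fps (fwd_diff 1 x))))"
    by (simp add: algebra_simps power2_eq_square)
  also have "\<dots> = ?X * (?A * (1 - fps_X) ^ 2 + fps_const (of_real a) * fps_X * (?B * (1 - fps_X)))
      - init_fps \<alpha> \<beta> a (x 0) (x 1)"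
    unfolding fps_X_mult_fwd_diff_1 fps_X2_mult_fwd_diff_2 init_fps_def fps_const_mult[symmetric]
    by algebra
  also have "?A * (1 - fps_X) ^ 2 = one_minus_X_powr \<alpha>"
    using one_minus_X_powr_add_1[of "\<alpha> - 2"] one_minus_X_powr_add_1[of "\<alpha> - 1"]
    by (simp add: power2_eq_square mult_ac)
  also have "?B * (1 - fps_X) = one_minus_X_powr \<beta>"
    using one_minus_X_powr_add_1[of "\<beta> - 1"] by simp
  also have "fps_X ^ 2 * (fps_const (b - 1) * ?X) = - (?X * (fps_const (1 - b) * fps_X ^ 2))"
  proof -
    have "fps_const (b - 1) = - fps_const (1 - b)" by (simp add: fps_eq_iff)
    then show ?thesis by (simp only: mult_minus_left mult_minus_right mult_ac)
  qed
  finally show ?thesis by (simp add: char_fps_def algebra_simps)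
qed

section \<open>Stability and zeros in the closed unit disc\<close>

definition char_rev :: "real \<Rightarrow> real \<Rightarrow> real \<Rightarrow> complex \<Rightarrow> complex \<Rightarrow> complex" where
  "char_rev \<alpha> \<beta> a b w = (1 - w) powr of_real \<alpha> + of_real a * w * (1 - w) powr of_real \<beta> + (1 - b) * w ^ 2"

lemma char_rev_0 [simp]: "char_rev \<alpha> \<beta> a b 0 = 1"
  by (simp add: char_rev_def)

lemma eval_fps_arith_unit_disc:
  fixes f g :: "complex fps"
  assumes "fps_conv_radius f \<ge> 1" "fps_conv_radius g \<ge> 1" "norm w < 1"
  shows "eval_fps (f + g) w = eval_fps f w + eval_fps g w"
    and "eval_fps (f * g) w = eval_fps f w * eval_fps g w"
    and "fps_conv_radius (f + g) \<ge> 1" and "fps_conv_radius (f * g) \<ge> 1"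
proof -
  have r: "ereal (norm w) < fps_conv_radius f" "ereal (norm w) < fps_conv_radius g"
    using assms by (auto intro: less_le_trans[of "ereal (norm w)" 1])
  then show "eval_fps (f + g) w = eval_fps f w + eval_fps g w" by (rule eval_fps_add)
  show "eval_fps (f * g) w = eval_fps f w * eval_fps g w" using r by (rule eval_fps_mult)
  show "fps_conv_radius (f + g) \<ge> 1" "fps_conv_radius (f * g) \<ge> 1"
    using assms fps_conv_radius_add[of f g] fps_conv_radius_mult[of f g]
    by (auto intro: order_trans[of 1 "min (fps_conv_radius f) (fps_conv_radius g)"])
qed

lemma eval_char_fps:
  assumes "norm w < 1"
  shows "eval_fps (char_fps \<alpha> \<beta> a b) w = char_rev \<alpha> \<beta> a b w"
  using assms
  by (simp add: char_fps_def char_rev_def power2_eq_square eval_fps_arith_unit_disc one_minus_X_powr_conv_radius eval_one_minus_X_powr)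

lemma abs_summable_char_fps:
  assumes "\<alpha> > 0" "\<beta> > 0"
  shows "abs_summable_fps (char_fps \<alpha> \<beta> a b)"
  unfolding char_fps_def
  by (intro abs_summable_fps_add abs_summable_fps_mult abs_summable_fps_const abs_summable_fps_X
      abs_summable_fps_power abs_summable_one_minus_X_powr assms)

text \<open>On the closed disc \<open>1 - w\<close> has nonnegative real part, so it meets the
  branch cut only at \<open>0\<close>, where powers with positive exponent are still
  continuous.\<close>

lemma continuous_on_char_rev:
  assumes "\<alpha> > 0" "\<beta> > 0"
  shows "continuous_on (cball 0 1) (char_rev \<alpha> \<beta> a b)"
proof -
  have "cball (0 :: complex) 1 \<subseteq> {w. 0 \<le> Re (1 - w) \<or> Im (1 - w) \<noteq> 0}"
    by (auto simp: dist_norm) (meson complex_Re_le_cmod order_trans)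
  then show ?thesis
    unfolding char_rev_def[abs_def]
    by (intro continuous_intros) (use assms in auto)
qed

text \<open>The half-plane contains the unit circle except \<open>1\<close>. This gives derivatives
  at zeros on the circle and along the boundary curve, which the open disc would not.\<close>

lemma holomorphic_on_char_rev: "char_rev \<alpha> \<beta> a b holomorphic_on {w. Re w < 1}"
  unfolding char_rev_def[abs_def]
  by (intro holomorphic_intros) (auto simp: complex_nonpos_Reals_iff)

lemma Re_less_1_if_norm_le_1:
  assumes "norm w \<le> 1" "w \<noteq> 1"
  shows "Re w < 1"
proof (rule ccontr)
  assume "\<not> Re w < 1"
  with complex_Re_le_cmod[of w] assms have "Re w = 1" "norm w = 1" by auto
  then have "Im w = 0" by (simp add: cmod_def)
  with \<open>Re w = 1\<close> assms show False by (simp add: complex_eq_iff)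
qed

lemma init_fps_tendsto_0:
  assumes "0 < \<beta>" "1 < \<alpha>"
  shows "(\<lambda>n. fps_nth (init_fps \<alpha> \<beta> a x0 x1) n) \<longlonglongrightarrow> 0"
proof -
  have "(\<lambda>n. fps_nth ((fps_const x0 * (1 - 2 * fps_X) + fps_const x1 * fps_X) * one_minus_X_powr (\<alpha> - 2)) n) \<longlonglongrightarrow> 0"
    by (intro fps_mult_tendsto_0 one_minus_X_powr_tendsto_0 abs_summable_fps_add abs_summable_fps_mult
        abs_summable_fps_diff abs_summable_fps_1 abs_summable_fps_const abs_summable_fps_X
        abs_summable_fps_const[of 2, unfolded numeral_fps_const[symmetric]]) (use assms in auto)
  moreover have "(\<lambda>n. fps_nth ((fps_const (of_real a * x0) * fps_X) * one_minus_X_powr (\<beta> - 1)) n) \<longlonglongrightarrow> 0"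
    by (intro fps_mult_tendsto_0 one_minus_X_powr_tendsto_0 abs_summable_fps_mult
        abs_summable_fps_const abs_summable_fps_X) (use assms in auto)
  ultimately show ?thesis
    unfolding init_fps_def fps_add_nth
    by (subst mult.commute[of "one_minus_X_powr (\<alpha> - 2)"]) (rule tendsto_add_zero)
qed

lemma char_fps_nth_0: "fps_nth (char_fps \<alpha> \<beta> a b) 0 = 1"
  by (simp add: char_fps_def one_minus_X_powr_nth)

lemma zero_asymp_stable_if_no_zeros:
  assumes "0 < \<beta>" "\<beta> \<le> 1" "1 < \<alpha>" "\<alpha> \<le> 2"
    and nz: "\<And>w. norm w \<le> 1 \<Longrightarrow> char_rev \<alpha> \<beta> a b w \<noteq> 0"
  shows "zero_asymp_stable \<alpha> \<beta> a b"
proof -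
  let ?P = "char_fps \<alpha> \<beta> a b" and ?N = "init_fps \<alpha> \<beta> a"
  have "continuous_on (cball 0 1) (\<lambda>w. norm (char_rev \<alpha> \<beta> a b w))"
    using assms by (intro continuous_intros continuous_on_char_rev) auto
  \<comment> \<open>The minimum of the modulus over the compact disc is positive and serves as the
    lower bound \<open>m\<close> in Wiener's lemma.\<close>
  then obtain w0 :: complex where w0: "w0 \<in> cball 0 1"
    "\<And>w. w \<in> cball 0 1 \<Longrightarrow> norm (char_rev \<alpha> \<beta> a b w0) \<le> norm (char_rev \<alpha> \<beta> a b w)"
    using continuous_attains_inf[of "cball (0::complex) 1"] by (metis cball_eq_empty compact_cball not_one_less_zero)
  have inv: "abs_summable_fps (inverse ?P)"
  proof (rule Wiener_abs_summable_fps_inverse)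
    show "norm (char_rev \<alpha> \<beta> a b w0) > 0" using w0(1) nz[of w0] by simp
    show "norm (char_rev \<alpha> \<beta> a b w0) \<le> norm (eval_fps ?P w)" if "norm w < 1" for w
      using w0(2)[of w] that by (simp add: eval_char_fps)
  qed (use assms in \<open>auto intro: abs_summable_char_fps\<close>)
  have sol: "Abs_fps x = inverse ?P * ?N (x 0) (x 1)" if "is_solution \<alpha> \<beta> a b x" for x
  proof -
    have "Abs_fps x * ?P = ?N (x 0) (x 1)" using that assms by (simp add: is_solution_iff_fps)
    then have "inverse ?P * ?N (x 0) (x 1) = (inverse ?P * ?P) * Abs_fps x" by (simp add: mult_ac)
    then show ?thesis by (simp add: inverse_mult_eq_1 char_fps_nth_0)
  qed
  have lim: "(\<lambda>n. fps_nth (inverse ?P * ?N x0 x1) n) \<longlonglongrightarrow> 0" for x0 x1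
    using assms by (intro fps_mult_tendsto_0 inv init_fps_tendsto_0) auto
  have attr: "zero_attractive \<alpha> \<beta> a b"
    unfolding zero_attractive_def
  proof (intro allI impI)
    fix x assume "is_solution \<alpha> \<beta> a b x"
    from lim[of "x 0" "x 1", folded sol[OF this]] show "x \<longlonglongrightarrow> 0" by simp
  qed
  \<comment> \<open>\<open>K\<close> and \<open>M\<close> bound the solutions with initial data
    \<open>(1, 0)\<close> and \<open>(0, 1)\<close>. Every solution is a superposition of these two,
    hence the choice \<open>\<delta> = \<epsilon> / (K + M)\<close> below.\<close>
  obtain K where K: "K > 0" "\<And>n. norm (fps_nth (inverse ?P * ?N 1 0) n) \<le> K"
    using convergent_imp_Bseq[OF convergentI[OF lim]] unfolding Bseq_def by blast
  obtain M where M: "M > 0" "\<And>n. norm (fps_nth (inverse ?P * ?N 0 1) n) \<le> M"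
    using convergent_imp_Bseq[OF convergentI[OF lim]] unfolding Bseq_def by blast
  have lin: "?N x0 x1 = fps_const x0 * ?N 1 0 + fps_const x1 * ?N 0 1" for x0 x1
    by (simp add: init_fps_def algebra_simps flip: fps_const_mult)
  have "zero_stable \<alpha> \<beta> a b"
    unfolding zero_stable_def
  proof (intro allI impI)
    fix \<epsilon> :: real assume "\<epsilon> > 0"
    show "\<exists>\<delta>>0. \<forall>x. is_solution \<alpha> \<beta> a b x \<and> norm (x 0) < \<delta> \<and> norm (x 1) < \<delta> \<longrightarrow> (\<forall>n. norm (x n) < \<epsilon>)"
    proof (intro exI[of _ "\<epsilon> / (K + M)"] conjI allI impI)
      show "\<epsilon> / (K + M) > 0" using \<open>\<epsilon> > 0\<close> K M by simp
      fix x n assume "is_solution \<alpha> \<beta> a b x \<and> norm (x 0) < \<epsilon> / (K + M) \<and> norm (x 1) < \<epsilon> / (K + M)"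
      then have x: "is_solution \<alpha> \<beta> a b x" "norm (x 0) < \<epsilon> / (K + M)" "norm (x 1) < \<epsilon> / (K + M)"
        by blast+
      have "Abs_fps x = fps_const (x 0) * (inverse ?P * ?N 1 0) + fps_const (x 1) * (inverse ?P * ?N 0 1)"
        unfolding sol[OF x(1)] by (subst lin) (simp add: algebra_simps)
      then have "x n = x 0 * fps_nth (inverse ?P * ?N 1 0) n + x 1 * fps_nth (inverse ?P * ?N 0 1) n"
        by (metis fps_add_nth fps_mult_left_const_nth fps_nth_Abs_fps)
      then have "norm (x n) \<le> norm (x 0) * norm (fps_nth (inverse ?P * ?N 1 0) n) + norm (x 1) * norm (fps_nth (inverse ?P * ?N 0 1) n)"
        by (metis norm_mult norm_triangle_ineq)
      also have "\<dots> \<le> norm (x 0) * K + norm (x 1) * M"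
        by (intro add_mono mult_left_mono K M) auto
      also have "\<dots> < \<epsilon> / (K + M) * K + \<epsilon> / (K + M) * M"
        by (intro add_strict_mono mult_strict_right_mono x K M)
      also have "\<dots> = \<epsilon>" using add_pos_pos[OF K(1) M(1)] by (simp flip: distrib_left add_divide_distrib)
      finally show "norm (x n) < \<epsilon>" .
    qed
  qed
  with attr show ?thesis by (simp add: zero_asymp_stable_def)
qed

text \<open>The first \<open>N\<close> terms contribute at most a constant \<open>C\<close>, which
  the factor \<open>1 - r\<close> kills. The others are at most \<open>e / 2\<close> times the
  geometric series, whose sum \<open>1 / (1 - r)\<close> that factor cancels.\<close>

lemma Abel_tendsto_0:
  fixes x :: "nat \<Rightarrow> complex"
  assumes x: "x \<longlonglongrightarrow> 0" and w: "norm w \<le> 1"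
  shows "((\<lambda>r. of_real (1 - r) * eval_fps (Abs_fps x) (of_real r * w)) \<longlongrightarrow> 0) (at_left 1)"
proof (rule tendstoI)
  fix e :: real assume e: "e > 0"
  obtain N where N: "\<And>n. n \<ge> N \<Longrightarrow> norm (x n) < e / 2"
    using LIMSEQ_D[OF x, of "e / 2"] e by auto
  define C where "C = (\<Sum>n<N. norm (x n))"
  have bound: "norm (of_real (1 - r) * eval_fps (Abs_fps x) (of_real r * w)) \<le> (1 - r) * C + e / 2"
    if r: "0 < r" "r < 1" for r
  proof -
    have tm: "norm (x n * (of_real r * w) ^ n) \<le> (if n < N then norm (x n) else 0) + e / 2 * r ^ n" for n
    proof -
      have "norm (x n * (of_real r * w) ^ n) \<le> norm (x n) * r ^ n"
        using r w by (auto simp: norm_mult norm_power intro!: mult_left_mono power_mono mult_left_le)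
      also have "\<dots> \<le> (if n < N then norm (x n) else 0) + e / 2 * r ^ n"
        using r N[of n] e by (auto intro!: mult_left_le power_le_one add_increasing2 mult_right_mono)
      finally show ?thesis .
    qed
    have "(\<lambda>n. if n < N then norm (x n) else 0) sums (\<Sum>n\<in>{..<N}. if n < N then norm (x n) else 0)"
      by (rule sums_finite) auto
    then have "(\<lambda>n. if n < N then norm (x n) else 0) sums C" unfolding C_def by simp
    moreover have "(\<lambda>n. e / 2 * r ^ n) sums (e / 2 * (1 / (1 - r)))"
      using r by (intro sums_mult geometric_sums) auto
    ultimately have s: "(\<lambda>n. (if n < N then norm (x n) else 0) + e / 2 * r ^ n) sums (C + e / 2 * (1 / (1 - r)))"
      by (rule sums_add)
    have "norm (eval_fps (Abs_fps x) (of_real r * w)) \<le> C + e / 2 * (1 / (1 - r))"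
      unfolding eval_fps_def sums_unique[OF s]
      using norm_suminf_le[OF _ sums_summable[OF s], of "\<lambda>n. x n * (of_real r * w) ^ n"] tm by simp
    then have "(1 - r) * norm (eval_fps (Abs_fps x) (of_real r * w)) \<le> (1 - r) * (C + e / 2 * (1 / (1 - r)))"
      using r by (intro mult_left_mono) auto
    also have "\<dots> = (1 - r) * C + e / 2" using r by (simp add: field_simps)
    finally show ?thesis using r unfolding norm_mult norm_of_real by simp
  qed
  have "((\<lambda>r. (1 - r) * C + e / 2) \<longlongrightarrow> (1 - 1) * C + e / 2) (at_left 1)"
    by (intro tendsto_intros)
  then have "\<forall>\<^sub>F r in at_left 1. (1 - r) * C + e / 2 < e"
    by (rule order_tendstoD(2)) (use e in auto)
  moreover have "\<forall>\<^sub>F r in at_left (1::real). r \<in> {0<..<1}"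
    by (rule eventually_at_left_real) auto
  ultimately show "\<forall>\<^sub>F r in at_left 1. dist (of_real (1 - r) * eval_fps (Abs_fps x) (of_real r * w)) 0 < e"
    by eventually_elim (use bound in \<open>auto intro: le_less_trans simp: dist_norm\<close>)
qed

lemma not_zero_attractive_if_zero:
  assumes "0 < \<beta>" "\<beta> \<le> 1" "1 < \<alpha>" "\<alpha> \<le> 2"
    and w: "norm w \<le> 1" and zero: "char_rev \<alpha> \<beta> a b w = 0"
  shows "\<not> zero_attractive \<alpha> \<beta> a b"
proof (cases "w = 1")
  case True
  \<comment> \<open>Both powers of \<open>1 - w\<close> vanish at \<open>w = 1\<close>, leaving
    \<open>1 - b\<close>.\<close>
  with zero assms have b: "b = 1" by (simp add: char_rev_def)
  have 1: "Abs_fps (\<lambda>_. 1) * (1 - fps_X) = (1 :: complex fps)"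
    by (rule fps_ext) (simp add: ring_distribs fps_X_mult_right_nth)
  have \<alpha>: "one_minus_X_powr \<alpha> = one_minus_X_powr (\<alpha> - 2) * (1 - fps_X) * (1 - fps_X)"
    using one_minus_X_powr_add_1[of "\<alpha> - 2"] one_minus_X_powr_add_1[of "\<alpha> - 1"] by simp
  have \<beta>: "one_minus_X_powr \<beta> = one_minus_X_powr (\<beta> - 1) * (1 - fps_X)"
    using one_minus_X_powr_add_1[of "\<beta> - 1"] by simp
  \<comment> \<open>Since \<open>1 / (1 - X)\<close> has all coefficients \<open>1\<close>, this
    factorization exhibits the constant sequence \<open>1\<close> as a solution.\<close>
  have P: "char_fps \<alpha> \<beta> a b = (1 - fps_X) * init_fps \<alpha> \<beta> a 1 1"
    unfolding b char_fps_def init_fps_def \<alpha> \<beta> by (simp add: algebra_simps)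
  have "Abs_fps (\<lambda>_. 1) * char_fps \<alpha> \<beta> a b = init_fps \<alpha> \<beta> a 1 1"
    unfolding P mult.assoc[symmetric] 1 by simp
  then have "is_solution \<alpha> \<beta> a b (\<lambda>_. 1)"
    unfolding is_solution_iff_fps[OF assms(1-4)] .
  moreover have "\<not> (\<lambda>_::nat. 1 :: complex) \<longlonglongrightarrow> 0"
    by (simp add: tendsto_const_iff)
  ultimately show ?thesis unfolding zero_attractive_def by blast
next
  case False
  let ?P = "char_fps \<alpha> \<beta> a b" and ?N = "init_fps \<alpha> \<beta> a 0 1"
  \<comment> \<open>Initial data \<open>0, 1\<close> reduce the numerator to
    \<open>X (1 - X) powr (\<alpha> - 2)\<close>, which is nonzero at \<open>w\<close>: the case
    \<open>w = 1\<close> is excluded, and \<open>w = 0\<close> is no zero of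
    \<open>char_rev\<close>.\<close>
  define X where "X = ?N * inverse ?P"
  define x where "x = fps_nth X"
  have X: "X = Abs_fps x" by (simp add: x_def fps_eq_iff)
  have XP: "X * ?P = ?N"
    by (simp add: X_def mult.assoc inverse_mult_eq_1 char_fps_nth_0)
  have N: "?N = one_minus_X_powr (\<alpha> - 2) * fps_X" by (simp add: init_fps_def)
  have "x 0 = 0" "x 1 = 1"
    by (simp_all add: x_def X_def N fps_mult_nth_1 char_fps_nth_0 one_minus_X_powr_nth)
  then have sol: "is_solution \<alpha> \<beta> a b x"
    using assms XP by (simp add: is_solution_iff_fps X)
  have Re: "Re w < 1" using w False by (rule Re_less_1_if_norm_le_1)
  have w0: "w \<noteq> 0" using zero by auto
  show ?thesis
  proof
    assume "zero_attractive \<alpha> \<beta> a b"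
    with sol have lim: "x \<longlonglongrightarrow> 0" by (simp add: zero_attractive_def)
    have "fps_conv_radius X \<ge> 1"
      using convergent_imp_Bseq[OF convergentI[OF lim]] unfolding Bseq_def x_def
      by (auto intro: fps_conv_radius_ge_1_if_bounded)
    moreover have "fps_conv_radius ?P \<ge> 1"
      using assms by (intro abs_summable_fps_conv_radius abs_summable_char_fps) auto
    ultimately have eval: "eval_fps X v * char_rev \<alpha> \<beta> a b v = v * (1 - v) powr of_real (\<alpha> - 2)" if "norm v < 1" for v
      using that arg_cong[OF XP, of "\<lambda>f. eval_fps f v"]
      by (simp add: N eval_fps_arith_unit_disc eval_char_fps one_minus_X_powr_conv_radius eval_one_minus_X_powr mult.commute)
    \<comment> \<open>Differentiability at \<open>w\<close>, even on the unit circle, makes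
      \<open>char_rev\<close> at \<open>r w\<close>, divided by \<open>r - 1\<close>, converge as
      \<open>r\<close> tends to \<open>1\<close>. Zeros inside the disc and on its boundary are thus
      treated alike.\<close>
    have "open {w. Re w < 1}" by (rule open_halfspace_Re_lt)
    then obtain D where "(char_rev \<alpha> \<beta> a b has_field_derivative D) (at w)"
      using holomorphic_on_char_rev[of \<alpha> \<beta> a b] Re
      by (metis (no_types, lifting) field_differentiable_def holomorphic_on_imp_differentiable_at mem_Collect_eq)
    then have "((\<lambda>z. char_rev \<alpha> \<beta> a b (z * w)) has_field_derivative D * w) (at 1)"
      by (intro DERIV_chain'[where f = "\<lambda>z. z * w"]) (auto intro!: derivative_eq_intros)
    then have "((\<lambda>z. (char_rev \<alpha> \<beta> a b (z * w) - char_rev \<alpha> \<beta> a b (1 * w)) / (z - 1)) \<longlongrightarrow> D * w) (at 1)"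
      by (simp add: has_field_derivative_iff)
    moreover have "filterlim complex_of_real (at 1) (at_left 1)"
      unfolding filterlim_at
      by (auto intro!: tendsto_eq_intros simp: eventually_at_filter)
    ultimately have "((\<lambda>r. (char_rev \<alpha> \<beta> a b (of_real r * w) - char_rev \<alpha> \<beta> a b (1 * w)) / (of_real r - 1)) \<longlongrightarrow> D * w) (at_left (1::real))"
      by (rule filterlim_compose)
    then have "((\<lambda>r. char_rev \<alpha> \<beta> a b (of_real r * w) / (of_real r - 1)) \<longlongrightarrow> D * w) (at_left (1::real))"
      by (simp add: zero)
    with Abel_tendsto_0[OF lim w] have "((\<lambda>r. of_real (1 - r) * eval_fps (Abs_fps x) (of_real r * w) *
        (char_rev \<alpha> \<beta> a b (of_real r * w) / (of_real r - 1))) \<longlongrightarrow> 0 * (D * w)) (at_left 1)"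
      by (rule tendsto_mult)
    then have prod: "((\<lambda>r. of_real (1 - r) * eval_fps (Abs_fps x) (of_real r * w) *
        (char_rev \<alpha> \<beta> a b (of_real r * w) / (of_real r - 1))) \<longlongrightarrow> 0) (at_left 1)"
      by simp
    have "\<forall>\<^sub>F r in at_left (1::real). r \<in> {0<..<1}"
      by (rule eventually_at_left_real) auto
    then have "\<forall>\<^sub>F r in at_left (1::real). of_real (1 - r) * eval_fps (Abs_fps x) (of_real r * w) *
        (char_rev \<alpha> \<beta> a b (of_real r * w) / (of_real r - 1))
        = - (of_real r * w * (1 - of_real r * w) powr of_real (\<alpha> - 2))"
    proof eventually_elim
      case (elim r)
      have "norm (of_real r * w) < 1"
        using elim w by (auto simp: norm_mult intro: le_less_trans[OF mult_left_le])
      from eval[OF this] have "eval_fps (Abs_fps x) (of_real r * w) * char_rev \<alpha> \<beta> a b (of_real r * w)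
        = of_real r * w * (1 - of_real r * w) powr of_real (\<alpha> - 2)" unfolding X .
      moreover have "of_real (1 - r) = - (of_real r - 1 :: complex)" "of_real r - 1 \<noteq> (0 :: complex)"
        using elim by auto
      ultimately show ?case by (simp add: field_simps)
    qed
    \<comment> \<open>By Abel's argument the product tends to \<open>0\<close>, yet it equals minus
      the numerator at \<open>r w\<close>, whose limit is nonzero.\<close>
    with prod have "((\<lambda>r. - (of_real r * w * (1 - of_real r * w) powr of_real (\<alpha> - 2))) \<longlongrightarrow> 0) (at_left (1::real))"
      by (rule Lim_transform_eventually)
    moreover have "((\<lambda>r. - (of_real r * w * (1 - of_real r * w) powr of_real (\<alpha> - 2)))
        \<longlongrightarrow> - (of_real 1 * w * (1 - of_real 1 * w) powr of_real (\<alpha> - 2))) (at_left (1::real))"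
      by (intro tendsto_intros) (use Re in \<open>auto simp: complex_nonpos_Reals_iff\<close>)
    ultimately have "- (of_real 1 * w * (1 - of_real 1 * w) powr of_real (\<alpha> - 2)) = 0"
      by (intro tendsto_unique[of "at_left (1::real)"]) (auto simp: trivial_limit_at_left_real)
    then show False using w0 False by simp
  qed
qed

lemma zero_asymp_stable_iff:
  assumes "0 < \<beta>" "\<beta> \<le> 1" "1 < \<alpha>" "\<alpha> \<le> 2"
  shows "zero_asymp_stable \<alpha> \<beta> a b \<longleftrightarrow> (\<forall>w. norm w \<le> 1 \<longrightarrow> char_rev \<alpha> \<beta> a b w \<noteq> 0)"
  using zero_asymp_stable_if_no_zeros[OF assms] not_zero_attractive_if_zero[OF assms]
  unfolding zero_asymp_stable_def by blast

section \<open>The index of the boundary curve\<close>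

text \<open>\<open>F\<close> is merely continuous on the unit circle, so the argument principle is
  applied on a smaller circle around all zeros. No zero lies between the circles, and the two image
  loops are homotopic in the punctured plane. The winding number is then the sum of the orders of
  the zeros.\<close>

lemma winding_number_circlepath_image_eq_0_iff:
  assumes cont: "continuous_on (cball 0 1) F" and hol: "F holomorphic_on ball 0 1"
    and nz: "\<And>w. norm w = 1 \<Longrightarrow> F w \<noteq> 0"
  shows "winding_number (F \<circ> circlepath 0 1) 0 = 0 \<longleftrightarrow> (\<forall>w. norm w < 1 \<longrightarrow> F w \<noteq> 0)"
proof -
  define Z where "Z = {w \<in> cball 0 1. F w = 0}"
  have Z_eq: "Z = {w \<in> ball 0 1. F w = 0}"
    using nz by (auto simp: Z_def less_le)
  have "closed Z"
  proof -
    have "Z = cball 0 1 \<inter> F -` {0}" by (auto simp: Z_def)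
    then show ?thesis using continuous_closed_preimage[OF cont closed_cball closed_singleton[of 0]] by simp
  qed
  moreover have "bounded Z" unfolding Z_def by (rule bounded_subset[OF bounded_cball[of 0 1]]) auto
  ultimately have compact: "compact Z" by (simp add: compact_eq_bounded_closed)
  \<comment> \<open>The compact zero set has an element of largest modulus, below \<open>1\<close>;
    \<open>r\<close> is halfway between that modulus and \<open>1\<close>.\<close>
  obtain r where r: "0 < r" "r < 1" "\<And>w. w \<in> Z \<Longrightarrow> norm w < r"
  proof (cases "Z = {}")
    case True
    then show ?thesis using that[of "1 / 2"] by auto
  next
    case False
    then obtain z where z: "z \<in> Z" "\<And>w. w \<in> Z \<Longrightarrow> norm w \<le> norm z"
      using continuous_attains_sup[OF compact False continuous_on_norm_id] by auto
    then have "norm z < 1" by (simp add: Z_eq)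
    show ?thesis
    proof (rule that[of "(norm z + 1) / 2"])
      show "0 < (norm z + 1) / 2" by (simp add: add_nonneg_pos)
      show "(norm z + 1) / 2 < 1" using \<open>norm z < 1\<close> by simp
      show "norm w < (norm z + 1) / 2" if "w \<in> Z" for w
        using z(2)[OF that] \<open>norm z < 1\<close> by simp
    qed
  qed
  have nz_r: "F w \<noteq> 0" if "norm w = r" for w
    using r(2) r(3)[of w] that by (auto simp: Z_def)
  have finite: "finite Z"
  proof (cases "Z = {}")
    case False
    then obtain z where z: "z \<in> ball 0 1" "F z = 0" by (auto simp: Z_eq)
    \<comment> \<open>A constant \<open>F\<close> with a zero would vanish on the closed disc by
      continuity, in particular at \<open>1\<close>.\<close>
    have "\<not> F constant_on ball 0 1"
    proof
      assume "F constant_on ball 0 1"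
      with z have "ball 0 1 \<subseteq> Z" unfolding Z_eq constant_on_def by force
      then have "closure (ball 0 1) \<subseteq> Z" using \<open>closed Z\<close> by (rule closure_minimal)
      then have "1 \<in> Z" by (auto simp: closure_ball)
      then show False using nz[of 1] by (simp add: Z_def)
    qed
    then have "finite {w \<in> Z. F w = 0}"
      using hol compact by (intro holomorphic_compact_finite_zeros) (auto simp: Z_eq)
    then show ?thesis by (simp add: Z_eq)
  qed simp
  have "homotopic_loops (-{0}) (F \<circ> circlepath 0 r) (F \<circ> circlepath 0 1)"
  proof (rule homotopic_loops_continuous_image)
    let ?A = "cball 0 1 - ball 0 r :: complex set"
    show "homotopic_loops ?A (circlepath 0 r) (circlepath 0 1)"
    proof (rule homotopic_loops_linear)
      fix t :: real
      have eq: "(1 - u) *\<^sub>R circlepath 0 r t + u *\<^sub>R circlepath 0 1 t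
          = of_real ((1 - u) * r + u) * exp (2 * of_real pi * \<i> * of_real t)" for u
        by (simp add: circlepath scaleR_conv_of_real algebra_simps)
      show "closed_segment (circlepath 0 r t) (circlepath 0 1 t) \<subseteq> ?A"
      proof
        fix v assume "v \<in> closed_segment (circlepath 0 r t) (circlepath 0 1 t)"
        then obtain u where u: "0 \<le> u" "u \<le> 1"
          and v: "v = of_real ((1 - u) * r + u) * exp (2 * of_real pi * \<i> * of_real t)"
          unfolding closed_segment_def eq by auto
        have "norm v = \<bar>(1 - u) * r + u\<bar>" unfolding v norm_mult norm_of_real by simp
        moreover have "(1 - u) * r + u = r + u * (1 - r)" "(1 - u) * r + u = 1 - (1 - u) * (1 - r)"
          by (simp_all add: algebra_simps)
        moreover have "u * (1 - r) \<ge> 0" "(1 - u) * (1 - r) \<ge> 0" using u r by auto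
        ultimately show "v \<in> ?A" using r by auto
      qed
    qed (use r in auto)
    show "continuous_on ?A F" using cont by (rule continuous_on_subset) auto
    show "F \<in> ?A \<rightarrow> - {0}" using r(3) by (fastforce simp: Z_def)
  qed
  then have "winding_number (F \<circ> circlepath 0 1) 0 = winding_number (F \<circ> circlepath 0 r) 0"
    by (simp add: winding_number_homotopic_loops)
  also have "\<dots> = 1 / (2 * pi * \<i>) * contour_integral (F \<circ> circlepath 0 r) (\<lambda>w. 1 / (w - 0))"
  proof (rule winding_number_valid_path)
    show "valid_path (F \<circ> circlepath 0 r)"
      by (rule valid_path_compose_holomorphic[OF _ hol]) (use r in auto)
    show "0 \<notin> path_image (F \<circ> circlepath 0 r)"
      using r(1) nz_r unfolding path_image_compose by fastforce
  qed
  also have "contour_integral (F \<circ> circlepath 0 r) (\<lambda>w. 1 / (w - 0))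
      = contour_integral (circlepath 0 r) (\<lambda>w. deriv F w * (1 / (F w - 0)))"
    using hol r by (intro contour_integral_comp_analyticW[where s = "ball 0 1"]) (auto simp: analytic_on_open)
  also have "\<dots> = contour_integral (circlepath 0 r) (\<lambda>w. deriv F w * 1 / F w)"
    by simp
  also have "\<dots> = 2 * pi * \<i> * (\<Sum>p\<in>{w \<in> ball 0 1. F w = 0 \<or> w \<in> {}}. winding_number (circlepath 0 r) p * 1 * zorder F p)"
  proof (rule argument_principle)
    show "\<forall>z. z \<notin> ball 0 1 \<longrightarrow> winding_number (circlepath 0 r) z = 0"
      using r by (intro allI impI winding_number_zero_outside[where s = "ball 0 1"]) auto
  qed (use hol r nz_r finite in \<open>auto simp: Z_eq\<close>)
  also have "(\<Sum>p\<in>{w \<in> ball 0 1. F w = 0 \<or> w \<in> {}}. winding_number (circlepath 0 r) p * 1 * zorder F p)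
      = of_int (\<Sum>p\<in>Z. zorder F p)"
    unfolding of_int_sum using r by (intro sum.cong) (auto simp: Z_eq winding_number_circlepath)
  finally have "winding_number (F \<circ> circlepath 0 1) 0 = of_int (\<Sum>p\<in>Z. zorder F p)"
    by (simp add: o_def)
  moreover have "(\<Sum>p\<in>Z. zorder F p) = 0 \<longleftrightarrow> Z = {}"
  proof -
    \<comment> \<open>A zero has positive order once \<open>F\<close> is not identically zero; the
      point \<open>r\<close> on the zero-free circle witnesses this.\<close>
    have "zorder F p > 0" if "p \<in> Z" for p
    proof -
      have "\<exists>w\<in>ball 0 1. F w \<noteq> 0"
        using r(1,2) nz_r[of "of_real r"] by (intro bexI[of _ "of_real r"]) auto
      from zorder_exist_zero[OF hol open_ball connected_ball _ this, of p] that
      show ?thesis unfolding Z_eq by simp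
    qed
    then have "Z \<noteq> {} \<Longrightarrow> (\<Sum>p\<in>Z. zorder F p) > 0" using finite by (intro sum_pos) auto
    then show ?thesis by (metis less_irrefl sum.empty)
  qed
  ultimately have "winding_number (F \<circ> circlepath 0 1) 0 = 0 \<longleftrightarrow> Z = {}" by (simp only: of_int_eq_0_iff)
  then show ?thesis unfolding Z_eq by auto
qed

text \<open>Near \<open>t\<close> the increment \<open>q s - q t\<close> has imaginary part below
  \<open>pi\<close> in absolute value, so it equals the principal logarithm of
  \<open>p s / p t\<close>. That quotient is \<open>1\<close> at \<open>t\<close>, where
  \<open>Ln\<close> is differentiable.\<close>

lemma has_vector_derivative_continuous_log:
  fixes q :: "real \<Rightarrow> complex"
  assumes "open S" "t \<in> S" and q: "continuous_on S q"
    and p: "(p has_vector_derivative p') (at t)" and exp: "\<And>s. s \<in> S \<Longrightarrow> p s = exp (q s)"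
  shows "(q has_vector_derivative p' / p t) (at t)"
proof -
  have pt: "p t \<noteq> 0" using exp[OF \<open>t \<in> S\<close>] by simp
  have "isCont q t" using q assms by (simp add: continuous_on_eq_continuous_at)
  then have "((\<lambda>s. q s - q t) \<longlongrightarrow> 0) (nhds t)"
    by (auto simp: isCont_def tendsto_nhds_iff intro: LIM_zero)
  then have "\<forall>\<^sub>F s in nhds t. dist (q s - q t) 0 < pi" by (rule tendstoD) simp
  moreover have "\<forall>\<^sub>F s in nhds t. s \<in> S" using assms by (intro eventually_nhds_in_open)
  ultimately have ev: "\<forall>\<^sub>F s in nhds t. q t + Ln (p s / p t) = q s"
  proof eventually_elim
    case (elim s)
    have "\<bar>Im (q s - q t)\<bar> < pi"
      using elim abs_Im_le_cmod[of "q s - q t"] by (simp add: dist_norm del: minus_complex.simps)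
    then have "Ln (exp (q s - q t)) = q s - q t" by (intro Ln_exp) auto
    moreover have "p s / p t = exp (q s - q t)"
      using elim assms by (simp add: exp_diff)
    ultimately show ?case by simp
  qed
  have "((\<lambda>s. p s / p t) has_vector_derivative p' / p t) (at t)"
    using p by (rule has_vector_derivative_divide)
  moreover have "(Ln has_field_derivative inverse (p t / p t)) (at (p t / p t))"
    using pt by (intro has_field_derivative_Ln) auto
  ultimately have "(Ln \<circ> (\<lambda>s. p s / p t) has_vector_derivative p' / p t * inverse (p t / p t)) (at t)"
    by (rule field_vector_diff_chain_at)
  then have "((\<lambda>s. q t + Ln (p s / p t)) has_vector_derivative 0 + p' / p t) (at t)"
    using pt by (intro has_vector_derivative_add) (auto simp: o_def)
  then have "((\<lambda>s. q t + Ln (p s / p t)) has_vector_derivative p' / p t) (at t)"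
    by simp
  moreover obtain T where "open T" "t \<in> T" "\<And>s. s \<in> T \<Longrightarrow> q t + Ln (p s / p t) = q s"
    using ev unfolding eventually_nhds by blast
  ultimately show ?thesis by (rule has_vector_derivative_transform_within_open)
qed

text \<open>
  The gauge integral needs no bound on the derivative near the end points: the fundamental theorem of
  calculus only asks for a primitive that is continuous up to them.
\<close>

lemma curve_index_eq_log_diff:
  assumes q: "continuous_on {0..2 * pi} q"
    and exp: "\<And>t. t \<in> {0..2 * pi} \<Longrightarrow> \<eta> t - l = exp (q t)"
    and \<eta>: "\<And>t. t \<in> {0<..<2 * pi} \<Longrightarrow> \<eta> differentiable at t"
  shows "curve_index \<eta> l = (q (2 * pi) - q 0) / (2 * of_real pi * \<i>)"
proof -
  have "((\<lambda>t. vector_derivative \<eta> (at t) / (\<eta> t - l)) has_integral q (2 * pi) - q 0) {0..2 * pi}"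
  proof (rule fundamental_theorem_of_calculus_interior)
    fix t assume t: "t \<in> {0<..<2 * pi}"
    have "(\<eta> has_vector_derivative vector_derivative \<eta> (at t)) (at t)"
      using \<eta>[OF t] by (simp add: vector_derivative_works)
    from has_vector_derivative_diff[OF this has_vector_derivative_const]
    have "((\<lambda>s. \<eta> s - l) has_vector_derivative vector_derivative \<eta> (at t)) (at t)"
      by simp
    then show "(q has_vector_derivative vector_derivative \<eta> (at t) / (\<eta> t - l)) (at t)"
      by (rule has_vector_derivative_continuous_log[OF open_greaterThanLessThan t, rotated])
         (use exp in \<open>auto intro: continuous_on_subset[OF q]\<close>)
  qed (use q in auto)
  then show ?thesis
    unfolding curve_index_def by (simp add: integral_unique)
qed

text \<open>Both sides are the increment of a continuous logarithm divided by
  \<open>2 pi \<i>\<close>. The link makes the openness of the level sets of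
  \<open>winding_number\<close> available for the integral.\<close>

lemma curve_index_eq_winding_number:
  assumes cont: "continuous_on {0..2 * pi} \<eta>" and l: "l \<notin> \<eta> ` {0..2 * pi}"
    and \<eta>: "\<And>t. t \<in> {0<..<2 * pi} \<Longrightarrow> \<eta> differentiable at t"
  shows "curve_index \<eta> l = winding_number (\<lambda>t. \<eta> (2 * pi * t)) l"
proof -
  let ?p = "\<lambda>t. \<eta> (2 * pi * t)"
  have "path ?p"
    unfolding path_def by (rule continuous_on_compose2[OF cont]) (auto intro!: continuous_intros)
  moreover have "l \<notin> path_image ?p"
    using l by (auto simp: path_image_def)
  ultimately obtain q where q: "path q"
    "pathfinish q - pathstart q = 2 * of_real pi * \<i> * winding_number ?p l"
    "\<And>t. t \<in> {0..1} \<Longrightarrow> ?p t = l + exp (q t)"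
    by (rule winding_number_as_continuous_log) blast
  have "curve_index \<eta> l = (q (2 * pi / (2 * pi)) - q (0 / (2 * pi))) / (2 * of_real pi * \<i>)"
  proof (rule curve_index_eq_log_diff[OF _ _ \<eta>])
    show "continuous_on {0..2 * pi} (\<lambda>t. q (t / (2 * pi)))"
      by (rule continuous_on_compose2[OF q(1)[unfolded path_def]]) (auto intro!: continuous_intros)
    show "\<eta> t - l = exp (q (t / (2 * pi)))" if "t \<in> {0..2 * pi}" for t
      using q(3)[of "t / (2 * pi)"] that by simp
  qed
  then show ?thesis using q(2) by (simp add: pathfinish_def pathstart_def)
qed

section \<open>The boundary curve as an image of the unit circle\<close>

lemma char_fun_eq_char_rev: "z \<noteq> 0 \<Longrightarrow> char_fun \<alpha> \<beta> a b z = z ^ 2 * char_rev \<alpha> \<beta> a b (inverse z)"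
  by (simp add: char_fun_def char_rev_def field_simps power2_eq_square)

text \<open>The base has modulus \<open>2 * sin (\<theta> / 2)\<close> and argument
  \<open>(pi - \<theta>) / 2\<close>. The argument stays within \<open>pi / 2\<close> of
  \<open>0\<close>, so the principal power acts on modulus and argument separately.\<close>

lemma one_minus_exp_powr:
  assumes \<theta>: "\<theta> \<in> {0..2 * pi}"
  shows "(1 - inverse (exp (\<i> * of_real \<theta>))) powr of_real c
    = of_real (2 powr c * sin (\<theta> / 2) powr c) * exp (\<i> * of_real (c * (pi - \<theta>) / 2))"
proof -
  let ?s = "sin (\<theta> / 2)"
  have s0: "?s \<ge> 0" using \<theta> by (intro sin_ge_zero) auto
  have eq: "1 - inverse (exp (\<i> * of_real \<theta>)) = of_real (2 * ?s) * exp (\<i> * of_real ((pi - \<theta>) / 2))"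
  proof -
    have "cos \<theta> = 1 - 2 * ?s ^ 2" "sin \<theta> = 2 * ?s * cos (\<theta> / 2)"
      using cos_double_sin[of "\<theta> / 2"] sin_double[of "\<theta> / 2"] by simp_all
    moreover have "cos ((pi - \<theta>) / 2) = ?s" "sin ((pi - \<theta>) / 2) = cos (\<theta> / 2)"
      by (simp_all add: diff_divide_distrib cos_diff sin_diff)
    moreover have "inverse (exp (\<i> * of_real \<theta>)) = exp (\<i> * of_real (- \<theta>))"
      by (simp add: exp_minus)
    ultimately show ?thesis
      by (simp only: complex_eq_iff) (simp add: Re_exp Im_exp power2_eq_square)
  qed
  show ?thesis
  proof (cases "?s = 0")
    \<comment> \<open>At the end points the base is \<open>0\<close>, and both sides are
      \<open>0\<close> by the convention for \<open>0 powr c\<close>.\<close>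
    case True
    then show ?thesis unfolding eq by simp
  next
    case False
    with s0 have s: "2 * ?s > 0" by simp
    have "of_real (2 * ?s) * exp (\<i> * of_real ((pi - \<theta>) / 2))
        = exp (of_real (ln (2 * ?s)) + \<i> * of_real ((pi - \<theta>) / 2))"
      using s by (simp only: exp_add exp_of_real exp_ln)
    moreover have "Ln (exp (of_real (ln (2 * ?s)) + \<i> * of_real ((pi - \<theta>) / 2)))
        = of_real (ln (2 * ?s)) + \<i> * of_real ((pi - \<theta>) / 2)"
    proof (rule Ln_exp)
      have "0 \<le> \<theta>" "\<theta> \<le> 2 * pi" using \<theta> by auto
      then have "\<theta> < 3 * pi" "- pi \<le> \<theta>" using pi_gt_zero by linarith+
      then show "- pi < Im (of_real (ln (2 * ?s)) + \<i> * of_real ((pi - \<theta>) / 2))"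
        "Im (of_real (ln (2 * ?s)) + \<i> * of_real ((pi - \<theta>) / 2)) \<le> pi"
        by (simp_all add: field_simps)
    qed
    ultimately have "(1 - inverse (exp (\<i> * of_real \<theta>))) powr of_real c
        = exp (of_real (c * ln (2 * ?s)) + \<i> * of_real (c * (pi - \<theta>) / 2))"
      unfolding eq powr_def using s by (simp add: algebra_simps)
    also have "\<dots> = of_real ((2 * ?s) powr c) * exp (\<i> * of_real (c * (pi - \<theta>) / 2))"
      using s by (simp only: exp_add exp_of_real powr_def) simp
    also have "(2 * ?s) powr c = 2 powr c * ?s powr c" using s0 by (simp add: powr_mult)
    finally show ?thesis .
  qed
qed

lemma bd_curve_eq_char_fun:
  assumes "\<theta> \<in> {0..2 * pi}"
  shows "bd_curve \<alpha> \<beta> a \<theta> - b = char_fun \<alpha> \<beta> a b (exp (\<i> * of_real \<theta>))"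
proof -
  have e: "exp (\<i> * of_real (s + t)) = exp (\<i> * of_real s) * exp (\<i> * of_real t)" for s t
    by (simp add: exp_add algebra_simps)
  have \<alpha>: "\<alpha> * pi / 2 + \<theta> * (2 - \<alpha> / 2) = \<theta> + (\<theta> + \<alpha> * (pi - \<theta>) / 2)"
    and \<beta>: "\<beta> * pi / 2 + \<theta> * (1 - \<beta> / 2) = \<theta> + \<beta> * (pi - \<theta>) / 2"
    by (simp_all add: field_simps)
  show ?thesis
    unfolding bd_curve_def char_fun_def one_minus_exp_powr[OF assms] \<alpha> \<beta> e
    by (simp add: power2_eq_square algebra_simps)
qed

lemma bd_curve_eq_char_rev:
  assumes "\<theta> \<in> {0..2 * pi}"
  shows "bd_curve \<alpha> \<beta> a \<theta> - b = exp (2 * \<i> * of_real \<theta>) * char_rev \<alpha> \<beta> a b (exp (- \<i> * of_real \<theta>))"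
proof -
  have "bd_curve \<alpha> \<beta> a \<theta> - b = exp (\<i> * of_real \<theta>) ^ 2 * char_rev \<alpha> \<beta> a b (inverse (exp (\<i> * of_real \<theta>)))"
    unfolding bd_curve_eq_char_fun[OF assms] by (rule char_fun_eq_char_rev) simp
  then show ?thesis by (simp add: exp_minus mult.assoc flip: exp_double)
qed

lemma bd_curve_eq_Complex: "bd_curve \<alpha> \<beta> a \<theta> = Complex (bd_curve1 \<alpha> \<beta> a \<theta>) (bd_curve2 \<alpha> \<beta> a \<theta>)"
  by (simp add: bd_curve_def bd_curve1_def bd_curve2_def complex_eq_iff Re_exp Im_exp)

text \<open>Taking \<open>b = 0\<close> expresses the curve itself through \<open>char_rev\<close>,
  which is continuous also at the branch point \<open>w = 1\<close> reached at both ends.\<close>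

lemma continuous_on_bd_curve:
  assumes "\<alpha> > 0" "\<beta> > 0"
  shows "continuous_on {0..2 * pi} (bd_curve \<alpha> \<beta> a)"
proof -
  have "continuous_on {0..2 * pi} (\<lambda>\<theta>. exp (2 * \<i> * of_real \<theta>) * char_rev \<alpha> \<beta> a 0 (exp (- \<i> * of_real \<theta>)))"
    using assms
    by (intro continuous_intros continuous_on_compose2[OF continuous_on_char_rev]) auto
  then show ?thesis
    by (rule continuous_on_eq) (use bd_curve_eq_char_rev[of _ \<alpha> \<beta> a 0] in auto)
qed

text \<open>Strictly between the end points \<open>cos \<theta> < 1\<close>, which keeps
  \<open>exp (- \<i> * \<theta>)\<close> in the half-plane where \<open>char_rev\<close> is
  holomorphic.\<close>

lemma bd_curve_differentiable:
  assumes "\<theta> \<in> {0<..<2 * pi}"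
  shows "bd_curve \<alpha> \<beta> a differentiable at \<theta>"
proof -
  have "sin (\<theta> / 2) > 0" using assms by (intro sin_gt_zero) auto
  then have "cos \<theta> < 1" using cos_double_sin[of "\<theta> / 2"] by simp
  then have "Re (exp (- \<i> * of_real \<theta>)) < 1" by (simp add: Re_exp)
  moreover have "open {w. Re w < 1}" by (rule open_halfspace_Re_lt)
  ultimately obtain D where D: "(char_rev \<alpha> \<beta> a 0 has_field_derivative D) (at (exp (- \<i> * of_real \<theta>)))"
    using holomorphic_on_char_rev[of \<alpha> \<beta> a 0]
    by (metis (no_types, lifting) field_differentiable_def holomorphic_on_imp_differentiable_at mem_Collect_eq)
  have "((\<lambda>\<theta>. exp (- \<i> * of_real \<theta>)) has_vector_derivative - \<i> * exp (- \<i> * of_real \<theta>)) (at \<theta>)"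
    by (auto intro!: derivative_eq_intros has_vector_derivative_real_field)
  from field_vector_diff_chain_at[OF this D]
  have "((\<lambda>\<theta>. char_rev \<alpha> \<beta> a 0 (exp (- \<i> * of_real \<theta>))) has_vector_derivative - \<i> * exp (- \<i> * of_real \<theta>) * D) (at \<theta>)"
    by (simp add: o_def)
  moreover have "((\<lambda>\<theta>. exp (2 * \<i> * of_real \<theta>)) has_vector_derivative 2 * \<i> * exp (2 * \<i> * of_real \<theta>)) (at \<theta>)"
    by (auto intro!: derivative_eq_intros has_vector_derivative_real_field)
  ultimately have "(\<lambda>\<theta>. exp (2 * \<i> * of_real \<theta>) * char_rev \<alpha> \<beta> a 0 (exp (- \<i> * of_real \<theta>))) differentiable at \<theta>"
    by (intro differentiable_mult) (auto intro: differentiableI_vector)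
  then obtain D' where "((\<lambda>\<theta>. exp (2 * \<i> * of_real \<theta>) * char_rev \<alpha> \<beta> a 0 (exp (- \<i> * of_real \<theta>))) has_derivative D') (at \<theta>)"
    by (auto simp: differentiable_def)
  then have "(bd_curve \<alpha> \<beta> a has_derivative D') (at \<theta>)"
    by (rule has_derivative_transform_within_open[OF _ open_greaterThanLessThan assms])
       (use bd_curve_eq_char_rev[of _ \<alpha> \<beta> a 0] in auto)
  then show ?thesis by (auto simp: differentiable_def)
qed

lemma unit_circle_eq_exp:
  assumes "norm w = 1"
  obtains \<theta> where "\<theta> \<in> {0..2 * pi}" "w = exp (- \<i> * of_real \<theta>)"
proof -
  have "inverse w \<noteq> 0" "norm (inverse w) = 1" using assms by (auto simp: norm_inverse)
  then have "inverse w = exp (\<i> * of_real (Arg2pi (inverse w)))"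
    using Arg2pi_eq[of "inverse w"] by simp
  then have "w = exp (- \<i> * of_real (Arg2pi (inverse w)))"
    by (metis exp_minus inverse_inverse_eq mult_minus_left)
  then show ?thesis
    by (rule that[rotated]) (use Arg2pi_ge_0[of "inverse w"] Arg2pi_lt_2pi[of "inverse w"] in auto)
qed

lemma bd_curve_image_iff:
  "b \<in> bd_curve \<alpha> \<beta> a ` {0..2 * pi} \<longleftrightarrow> (\<exists>w. norm w = 1 \<and> char_rev \<alpha> \<beta> a b w = 0)"
proof
  assume "b \<in> bd_curve \<alpha> \<beta> a ` {0..2 * pi}"
  then obtain \<theta> where \<theta>: "\<theta> \<in> {0..2 * pi}" "bd_curve \<alpha> \<beta> a \<theta> - b = 0" by auto
  then show "\<exists>w. norm w = 1 \<and> char_rev \<alpha> \<beta> a b w = 0"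
    by (intro exI[of _ "exp (- \<i> * of_real \<theta>)"]) (simp add: bd_curve_eq_char_rev)
next
  assume "\<exists>w. norm w = 1 \<and> char_rev \<alpha> \<beta> a b w = 0"
  then obtain w where w: "norm w = 1" "char_rev \<alpha> \<beta> a b w = 0" by auto
  obtain \<theta> where \<theta>: "\<theta> \<in> {0..2 * pi}" "w = exp (- \<i> * of_real \<theta>)"
    by (rule unit_circle_eq_exp[OF w(1)])
  then have "bd_curve \<alpha> \<beta> a \<theta> - b = 0" using w by (simp add: bd_curve_eq_char_rev)
  then show "b \<in> bd_curve \<alpha> \<beta> a ` {0..2 * pi}" using \<theta> by (auto intro: image_eqI)
qed

text \<open>A logarithm of the curve minus \<open>b\<close> is \<open>2 * \<i> * \<theta>\<close>
  plus a logarithm of \<open>char_rev\<close> along \<open>exp (- \<i> * \<theta>)\<close>. The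
  first part contributes \<open>2\<close>; the second runs through the circle backwards, hence the
  minus sign.\<close>

lemma curve_index_bd_curve:
  assumes "\<alpha> > 0" "\<beta> > 0" and b: "b \<notin> bd_curve \<alpha> \<beta> a ` {0..2 * pi}"
  shows "curve_index (bd_curve \<alpha> \<beta> a) b = 2 - winding_number (char_rev \<alpha> \<beta> a b \<circ> circlepath 0 1) 0"
proof -
  let ?p = "char_rev \<alpha> \<beta> a b \<circ> circlepath 0 1"
  have "path ?p"
    using assms by (intro path_continuous_image continuous_on_subset[OF continuous_on_char_rev]) auto
  moreover have "0 \<notin> path_image ?p"
    using b by (auto simp: path_image_compose bd_curve_image_iff)
  ultimately obtain q where q: "path q"
    "pathfinish q - pathstart q = 2 * of_real pi * \<i> * winding_number ?p 0"
    "\<And>t. t \<in> {0..1} \<Longrightarrow> ?p t = 0 + exp (q t)"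
    by (rule winding_number_as_continuous_log) blast
  \<comment> \<open>The parameter \<open>1 - \<theta> / (2 * pi)\<close> of
    \<open>circlepath 0 1\<close> belongs to the point
    \<open>exp (- \<i> * \<theta>)\<close>.\<close>
  define Q where "Q = (\<lambda>\<theta>. 2 * \<i> * of_real \<theta> + q (1 - \<theta> / (2 * pi)))"
  have "curve_index (bd_curve \<alpha> \<beta> a) b = (Q (2 * pi) - Q 0) / (2 * of_real pi * \<i>)"
  proof (rule curve_index_eq_log_diff[OF _ _ bd_curve_differentiable])
    show "continuous_on {0..2 * pi} Q"
      unfolding Q_def
      by (intro continuous_intros continuous_on_compose2[OF q(1)[unfolded path_def]]) auto
    fix \<theta> assume \<theta>: "\<theta> \<in> {0..2 * pi}"
    have "circlepath 0 1 (1 - \<theta> / (2 * pi)) = exp (2 * of_real pi * \<i> + - \<i> * of_real \<theta>)"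
      by (simp add: circlepath algebra_simps)
    also have "\<dots> = exp (- \<i> * of_real \<theta>)" unfolding exp_add by simp
    finally have "char_rev \<alpha> \<beta> a b (exp (- \<i> * of_real \<theta>)) = exp (q (1 - \<theta> / (2 * pi)))"
      using q(3)[of "1 - \<theta> / (2 * pi)"] \<theta> by simp
    then show "bd_curve \<alpha> \<beta> a \<theta> - b = exp (Q \<theta>)"
      unfolding bd_curve_eq_char_rev[OF \<theta>] Q_def exp_add by simp
  qed auto
  moreover have "Q (2 * pi) - Q 0 = 2 * of_real pi * \<i> * (2 - winding_number ?p 0)"
    using q(2) by (simp add: Q_def pathfinish_def pathstart_def algebra_simps)
  ultimately show ?thesis by simp
qed

lemma zero_asymp_stable_iff_curve_index:
  assumes "0 < \<beta>" "\<beta> \<le> 1" "1 < \<alpha>" "\<alpha> \<le> 2" and b: "b \<notin> bd_curve \<alpha> \<beta> a ` {0..2 * pi}"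
  shows "zero_asymp_stable \<alpha> \<beta> a b \<longleftrightarrow> curve_index (bd_curve \<alpha> \<beta> a) b = 2"
proof -
  have nz: "char_rev \<alpha> \<beta> a b w \<noteq> 0" if "norm w = 1" for w
    using b that by (auto simp: bd_curve_image_iff)
  have "ball 0 1 \<subseteq> {w. Re w < 1}"
    by (auto intro: le_less_trans[OF complex_Re_le_cmod])
  then have "winding_number (char_rev \<alpha> \<beta> a b \<circ> circlepath 0 1) 0 = 0 \<longleftrightarrow> (\<forall>w. norm w < 1 \<longrightarrow> char_rev \<alpha> \<beta> a b w \<noteq> 0)"
    using assms nz
    by (intro winding_number_circlepath_image_eq_0_iff continuous_on_char_rev
        holomorphic_on_subset[OF holomorphic_on_char_rev]) auto
  then have "curve_index (bd_curve \<alpha> \<beta> a) b = 2 \<longleftrightarrow> (\<forall>w. norm w < 1 \<longrightarrow> char_rev \<alpha> \<beta> a b w \<noteq> 0)"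
    using assms by (simp add: curve_index_bd_curve)
  also have "\<dots> \<longleftrightarrow> zero_asymp_stable \<alpha> \<beta> a b"
    unfolding zero_asymp_stable_iff[OF assms(1-4)] using nz by (metis order_le_less)
  finally show ?thesis by simp
qed

text \<open>\<open>S \<union> C\<close> is closed and so contains the closure of \<open>S\<close>;
  removing the open set \<open>S\<close> from that closure leaves its points in
  \<open>C\<close>.\<close>

lemma frontier_eq_closure_Int:
  assumes "open S" "open (- (S \<union> C))" "S \<inter> C = {}"
  shows "frontier S = closure S \<inter> C"
proof -
  have "closure S \<subseteq> S \<union> C"
    using assms(2) by (intro closure_minimal) (auto simp: closed_def)
  then show ?thesis using assms by (auto simp: frontier_def interior_open)
qed

theorem theorem3p1:
  fixes \<alpha> \<beta> a :: real
  assumes "0 < \<beta>" and "\<beta> \<le> 1" and "1 < \<alpha>" and "\<alpha> \<le> 2" and "a > 0"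
  shows
    "(\<forall>b. \<forall>\<theta>\<in>{0..2 * pi}. bd_curve \<alpha> \<beta> a \<theta> - b = char_fun \<alpha> \<beta> a b (exp (\<i> * of_real \<theta>)))
   \<and> (\<forall>b. b \<notin> bd_curve \<alpha> \<beta> a ` {0..2 * pi} \<longrightarrow>
        (zero_asymp_stable \<alpha> \<beta> a b \<longleftrightarrow> curve_index (bd_curve \<alpha> \<beta> a) b = 2))
   \<and> stability_region \<alpha> \<beta> a
       = {b \<in> UNIV - bd_curve \<alpha> \<beta> a ` {0..2 * pi}. curve_index (bd_curve \<alpha> \<beta> a) b = 2}
   \<and> frontier (stability_region \<alpha> \<beta> a)
       = closure (stability_region \<alpha> \<beta> a) \<inter> bd_curve \<alpha> \<beta> a ` {0..2 * pi}
   \<and> (\<forall>\<theta>\<in>{0..2 * pi}.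
        bd_curve \<alpha> \<beta> a \<theta> = Complex (bd_curve1 \<alpha> \<beta> a \<theta>) (bd_curve2 \<alpha> \<beta> a \<theta>))"
proof -
  let ?\<gamma> = "bd_curve \<alpha> \<beta> a" and ?C = "bd_curve \<alpha> \<beta> a ` {0..2 * pi}"
  have index: "zero_asymp_stable \<alpha> \<beta> a b \<longleftrightarrow> curve_index ?\<gamma> b = 2" if "b \<notin> ?C" for b
    using assms that by (intro zero_asymp_stable_iff_curve_index) auto
  \<comment> \<open>A point of the curve gives a zero of \<open>char_rev\<close> on the unit circle,
    so the region contains no point of the curve.\<close>
  have unstable: "\<not> zero_asymp_stable \<alpha> \<beta> a b" if "b \<in> ?C" for b
    using that unfolding bd_curve_image_iff zero_asymp_stable_iff[OF assms(1-4)] by (metis order_refl)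
  have region: "stability_region \<alpha> \<beta> a = {b \<in> UNIV - ?C. curve_index ?\<gamma> b = 2}"
    unfolding stability_region_def using index unstable by blast
  let ?p = "\<lambda>t. ?\<gamma> (2 * pi * t)"
  have cont: "continuous_on {0..2 * pi} ?\<gamma>" using assms by (intro continuous_on_bd_curve) auto
  have path: "path ?p"
    unfolding path_def by (rule continuous_on_compose2[OF cont]) (auto intro!: continuous_intros)
  have image: "path_image ?p = ?C"
  proof -
    have "(\<lambda>t. 2 * pi * t) ` {0..1} = {0..2 * pi}" by simp
    then show ?thesis unfolding path_image_def by (metis image_image)
  qed
  \<comment> \<open>Both end points have the value \<open>1\<close>, because the sine vanishes
    there.\<close>
  have loop: "pathfinish ?p = pathstart ?p"
    by (simp add: pathfinish_def pathstart_def bd_curve_def)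
  have winding: "curve_index ?\<gamma> b = winding_number ?p b" if "b \<notin> ?C" for b
    by (rule curve_index_eq_winding_number[OF cont that bd_curve_differentiable])
  have level: "open {b. b \<notin> ?C \<and> winding_number ?p b = k}" for k
    using open_winding_number_levelsets[OF path loop] unfolding image .
  have "stability_region \<alpha> \<beta> a = {b. b \<notin> ?C \<and> winding_number ?p b = 2}"
    unfolding region using winding by auto
  \<comment> \<open>Off the curve, the complement of the region is the union of the other level
    sets, each open. The index \<open>k\<close> runs over complex numbers, the type of
    \<open>winding_number\<close>.\<close>
  moreover have "- (stability_region \<alpha> \<beta> a \<union> ?C) = (\<Union>k\<in>-{2}. {b. b \<notin> ?C \<and> winding_number ?p b = k})"
    unfolding region using winding by auto
  ultimately have "frontier (stability_region \<alpha> \<beta> a) = closure (stability_region \<alpha> \<beta> a) \<inter> ?C"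
    using level unfolding region by (intro frontier_eq_closure_Int) (auto intro!: open_UN)
  then show ?thesis
    by (intro conjI allI ballI impI region bd_curve_eq_char_fun bd_curve_eq_Complex index)
qed

end
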